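(* In the two-phase linear regression model described in the context, assume the following. (i) $(X_t)$ is a stationary long-range dependent sequence of $d$-dimensional Gaussian (row) vectors with $E[X_t]=0$, $\Gamma(0)=\mathrm{Var}(X_1)$ and, for $t\ge 1$, covariance matrix $\Gamma(t)=E[X_1^TX_{t+1}]=\mathcal{L}(t)^TN(t)\mathcal{L}(t)$, where $N(t)=\mathrm{diag}(t^{-\theta_1},\dots,t^{-\theta_d})$, $\theta_1,\dots,\theta_d\in(0,1)$, and $\mathcal{L}(x)$ is a $d\times d$ orthogonal matrix of slowly varying functions. (ii) $(\varepsilon_t)$ is a stationary long-range dependent sequence of Gaussian variables with $E[\varepsilon_t]=0$, $\gamma(0)=\mathrm{Var}[\varepsilon_t]=\sigma_0^2$ and, for $t\ge1$, $\gamma(t)=E[\varepsilon_1\varepsilon_{t+1}]=t^{-\alpha}L(t)$, where $\alpha\in(0,1)$ and $L$ is a positive slowly varying function. (iii) The errors $\varepsilon_t$ are independent of the regressors $X_t$. (iv) $\psi=\rho'$ is differentiable and $\psi'(u)>0$ for all $u\in(0,c)$. (v) $\psi$ is twice differentiable with bounded second derivative. (vi) $\psi(x)/x$ is nonincreasing for $x>0$. (vii) The two segments are different: $\beta_1\ne\beta_2$ for the admissible parameters $\xi=(\beta_1,\beta_2,\pi)$, in particular $\beta_1^0\neq\beta_2^0$. Then the scale parameter S-estimator $\hat\sigma_n=s_n(\hat\beta_{1n},\hat\beta_{2n},\hat\pi_n)$ is strongly consistent for $\sigma_0$, i.e. $\hat\sigma_n\to\sigma_0$ almost surely as $n\to\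infty$.
   Context: Model. One observes $(Y_t,X_t)_{1\le t\le n}$ with $$Y_t=X_t\beta_1\mathbf{1}_{1\le t\le[n\pi]}+X_t\beta_2\mathbf{1}_{[n\pi]+1\le t\le n}+\varepsilon_t,\qquad t=1,\dots,n,$$ where $[\cdot]$ is the integer part, $\mathbf 1$ the indicator, $\pi\in(0,1)$, $\beta_1,\beta_2\in\Upsilon$, and $\Upsilon\subset\mathbb{R}^d$ ($d\ge1$) is compact. Put $\xi=(\beta_1,\beta_2,\pi)$. The error variance is $\sigma^2\in(0,\infty)$. The true values (generating the data) are $\xi^0=(\beta_1^0,\beta_2^0,\pi^0)$ and $\sigma_0^2$. A positive measurable function $h$ is slowly varying if $h(\lambda x)/h(x)\to1$ as $x\to\infty$ for every $\lambda>0$. The values $\theta_1,\dots,\theta_d,\alpha$ and the functions $\mathcal L, L$ are known. Function $\rho$. $\rho:\mathbb{R}\to[0,1]$ is symmetric, continuously differentiable, $\rho(0)=0$, and for some $c>0$ it is increasing on $[0,c)$ and constant on $[c,\infty)$. Write $\psi=\rho'$ and $K=E[\rho(\varepsilon_1/\sigma_0)]$, where $\varepsilon_1/\sigma_0$ is standard Gaussian. S-estimators. Let $r_t(\beta)=Y_t-X_t\beta$. For fixed $\xi$, $s_n(\xi)=s_n(\beta_1,\beta_2,\pi)$ is the positive solution $s$ of $$n^{-1}\sum_{t=1}^{[n\pi]}\rho\Big(\frac{r_t(\beta_1)}{s}\Big)+n^{-1}\sum_{t=[n\pi]+1}^{n}\rho\Big(\frac{r_t(\beta_2)}{s}\Big)=K$$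 (the supremum of all solutions if there are several; it is assumed throughout that at least one solution exists). Then $(\tilde\beta_{1n}(\pi),\tilde\beta_{2n}(\pi))=\arg\min_{(\beta_1,\beta_2)\in\Upsilon\times\Upsilon}s_n(\beta_1,\beta_2,\pi)$, $\hat\pi_n=\arg\min_{\pi\in[0,1]}s_n(\tilde\beta_{1n}(\pi),\tilde\beta_{2n}(\pi),\pi)$, and $(\hat\beta_{1n},\hat\beta_{2n})=(\tilde\beta_{1n}(\hat\pi_n),\tilde\beta_{2n}(\hat\pi_n))$.
   Formalization: As printed, (iv) contradicts ρ being constant on [c,∞), since ψ(0)=ψ(c)=0; here ψ'>0 is only required on (0,c') for some 0<c'≤c. In (i), entries of the orthogonal matrix may be slowly varying, negatives of such, or zero, as all-positive entries are impossible for d≥2. *)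

theory Defs
  imports "HOL-Probability.Probability"
begin

section \<open>Slowly varying functions\<close>

definition slowly_varying :: "(real \<Rightarrow> real) \<Rightarrow> bool" where
  "slowly_varying h \<longleftrightarrow>
     h \<in> borel_measurable (restrict_space borel {0<..}) \<and>
     (\<forall>x>0. h x > 0) \<and>
     (\<forall>a>0. ((\<lambda>x. h (a * x) / h x) \<longlongrightarrow> 1) at_top)"

text \<open>
  Entries of an orthogonal matrix of size at least 2 cannot all be positive functions.  Hence an
  entry is allowed to be the zero function or the negative of a slowly varying function.
\<close>

definition slowly_varying_entry :: "(real \<Rightarrow> real) \<Rightarrow> bool" where
  "slowly_varying_entry h \<longleftrightarrow>
     slowly_varying h \<or> slowly_varying (\<lambda>x. - h x) \<or> (\<forall>x>0. h x = 0)"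

definition slowly_varying_orthogonal :: "(real \<Rightarrow> real ^ 'd ^ 'd) \<Rightarrow> bool" where
  "slowly_varying_orthogonal Lm \<longleftrightarrow>
     (\<forall>x>0. orthogonal_matrix (Lm x)) \<and> (\<forall>i j. slowly_varying_entry (\<lambda>x. Lm x $ i $ j))"


section \<open>Stationary Gaussian sequences\<close>

text \<open>
  A sequence is indexed by \<open>t \<ge> 1\<close>; the value at index 0 is irrelevant.
\<close>

definition trajectory :: "(nat \<Rightarrow> 'w \<Rightarrow> 'b) \<Rightarrow> 'w \<Rightarrow> nat \<Rightarrow> 'b" where
  "trajectory Z \<omega> = (\<lambda>t\<in>{1..}. Z t \<omega>)"

abbreviation path_space :: "(nat \<Rightarrow> 'b::topological_space) measure" where
  "path_space \<equiv> Pi\<^sub>M {1..} (\<lambda>_. borel)"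

definition stationary :: "'w measure \<Rightarrow> (nat \<Rightarrow> 'w \<Rightarrow> 'b::topological_space) \<Rightarrow> bool" where
  "stationary M Z \<longleftrightarrow>
     (\<forall>h. distr M path_space (trajectory (\<lambda>t. Z (t + h))) = distr M path_space (trajectory Z))"

text \<open>
  The library's \<open>indep_var\<close> requires both random elements to have the same type; this is
  independence of the sigma-algebras generated by the two sequences.
\<close>

definition independent_sequences :: "'w measure \<Rightarrow> (nat \<Rightarrow> 'w \<Rightarrow> 'a::topological_space) \<Rightarrow>
    (nat \<Rightarrow> 'w \<Rightarrow> 'b::topological_space) \<Rightarrow> bool" where
  "independent_sequences M U V \<longleftrightarrow>
     prob_space.indep_set M
       (sets (vimage_algebra (space M) (trajectory U) path_space))
       (sets (vimage_algebra (space M) (trajectory V) path_space))"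

text \<open>Degenerate (constant) variables count as Gaussian, as needed for joint Gaussianity.\<close>

definition gaussian_rv :: "'w measure \<Rightarrow> ('w \<Rightarrow> real) \<Rightarrow> bool" where
  "gaussian_rv M V \<longleftrightarrow> V \<in> borel_measurable M \<and>
     (\<exists>m s. (s > 0 \<and> distributed M lborel V (normal_density m s)) \<or> (AE \<omega> in M. V \<omega> = m))"

definition gaussian_sequence ::
    "'w measure \<Rightarrow> (nat \<Rightarrow> 'w \<Rightarrow> 'b::euclidean_space) \<Rightarrow> bool" where
  "gaussian_sequence M Z \<longleftrightarrow>
     (\<forall>t\<ge>1. Z t \<in> borel_measurable M) \<and>
     (\<forall>J a. finite J \<and> J \<subseteq> {1..} \<longrightarrow> gaussian_rv M (\<lambda>\<omega>. \<Sum>t\<in>J. a t \<bullet> Z t \<omega>))"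

text \<open>
  Autocovariance matrix of a centred sequence of row vectors, the matrix of the expectations
  of \<open>X\<^sub>1\<^sup>T X\<^sub>t\<^sub>+\<^sub>1\<close>.
\<close>

definition autocov :: "'w measure \<Rightarrow> (nat \<Rightarrow> 'w \<Rightarrow> real ^ 'd) \<Rightarrow> nat \<Rightarrow> real ^ 'd ^ 'd" where
  "autocov M X t = (\<chi> i j. \<integral>\<omega>. X 1 \<omega> $ i * X (t + 1) \<omega> $ j \<partial>M)"

definition power_diag :: "('d \<Rightarrow> real) \<Rightarrow> nat \<Rightarrow> real ^ 'd ^ 'd" where
  "power_diag \<theta> t = (\<chi> i j. if i = j then real t powr (- \<theta> i) else 0)"


section \<open>The two-phase linear model\<close>

definition break_index :: "nat \<Rightarrow> real \<Rightarrow> nat" where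
  "break_index n p = nat \<lfloor>real n * p\<rfloor>"

text \<open>The responses depend on the sample size \<open>n\<close> through the break index.\<close>

definition response ::
    "(nat \<Rightarrow> real ^ 'd) \<Rightarrow> (nat \<Rightarrow> real) \<Rightarrow> real ^ 'd \<Rightarrow> real ^ 'd \<Rightarrow> real \<Rightarrow> nat \<Rightarrow> nat \<Rightarrow> real" where
  "response x e b1 b2 p n t =
     (x t \<bullet> b1) * of_bool (1 \<le> t \<and> t \<le> break_index n p) +
     (x t \<bullet> b2) * of_bool (break_index n p + 1 \<le> t \<and> t \<le> n) + e t"

definition admissible ::
    "(real ^ 'd) set \<Rightarrow> ((real ^ 'd) \<times> (real ^ 'd) \<times> real) set" where
  "admissible B = {(b1, b2, p). b1 \<in> B \<and> b2 \<in> B \<and> b1 \<noteq> b2 \<and> 0 < p \<and> p < 1}"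


section \<open>S-estimators\<close>

definition rho_function :: "(real \<Rightarrow> real) \<Rightarrow> real \<Rightarrow> bool" where
  "rho_function \<rho> c \<longleftrightarrow>
     (\<forall>u. 0 \<le> \<rho> u \<and> \<rho> u \<le> 1) \<and> (\<forall>u. \<rho> (- u) = \<rho> u) \<and> \<rho> C1_differentiable_on UNIV \<and> \<rho> 0 = 0 \<and>
     c > 0 \<and> strict_mono_on {0..<c} \<rho> \<and> (\<forall>u\<ge>c. \<rho> u = \<rho> c)"

definition residual :: "(nat \<Rightarrow> real) \<Rightarrow> (nat \<Rightarrow> real ^ 'd) \<Rightarrow> real ^ 'd \<Rightarrow> nat \<Rightarrow> real" where
  "residual y x b t = y t - x t \<bullet> b"

definition scale_solutions ::
    "(real \<Rightarrow> real) \<Rightarrow> real \<Rightarrow> (nat \<Rightarrow> real) \<Rightarrow> (nat \<Rightarrow> real ^ 'd) \<Rightarrow> nat \<Rightarrow>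
     real ^ 'd \<Rightarrow> real ^ 'd \<Rightarrow> real \<Rightarrow> real set" where
  "scale_solutions \<rho> K y x n b1 b2 p =
     {s. s > 0 \<and>
         (1 / real n) * (\<Sum>t = 1..break_index n p. \<rho> (residual y x b1 t / s)) +
         (1 / real n) * (\<Sum>t = break_index n p + 1..n. \<rho> (residual y x b2 t / s)) = K}"

definition s_scale ::
    "(real \<Rightarrow> real) \<Rightarrow> real \<Rightarrow> (nat \<Rightarrow> real) \<Rightarrow> (nat \<Rightarrow> real ^ 'd) \<Rightarrow> nat \<Rightarrow>
     real ^ 'd \<Rightarrow> real ^ 'd \<Rightarrow> real \<Rightarrow> real" where
  "s_scale \<rho> K y x n b1 b2 p = Sup (scale_solutions \<rho> K y x n b1 b2 p)"

definition scale_solvable ::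
    "(real \<Rightarrow> real) \<Rightarrow> real \<Rightarrow> (nat \<Rightarrow> real) \<Rightarrow> (nat \<Rightarrow> real ^ 'd) \<Rightarrow> nat \<Rightarrow> (real ^ 'd) set \<Rightarrow> bool" where
  "scale_solvable \<rho> K y x n B \<longleftrightarrow>
     (\<forall>b1\<in>B. \<forall>b2\<in>B. \<forall>p\<in>{0..1}. scale_solutions \<rho> K y x n b1 b2 p \<noteq> {})"

text \<open>
  The S-estimators are \<open>(bt1 ph, bt2 ph, ph)\<close>, where \<open>(bt1 p, bt2 p)\<close> is any choice of
  minimisers of the scale for the break fraction \<open>p\<close>, and \<open>ph\<close> minimises the resulting profile.
\<close>

definition is_S_estimator ::
    "(real \<Rightarrow> real) \<Rightarrow> real \<Rightarrow> (nat \<Rightarrow> real) \<Rightarrow> (nat \<Rightarrow> real ^ 'd) \<Rightarrow> nat \<Rightarrow> (real ^ 'd) set \<Rightarrow>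
     (real \<Rightarrow> real ^ 'd) \<Rightarrow> (real \<Rightarrow> real ^ 'd) \<Rightarrow> real \<Rightarrow> bool" where
  "is_S_estimator \<rho> K y x n B bt1 bt2 ph \<longleftrightarrow>
     (\<forall>p\<in>{0..1}. is_arg_min (\<lambda>(b1, b2). s_scale \<rho> K y x n b1 b2 p) (\<lambda>b. b \<in> B \<times> B) (bt1 p, bt2 p)) \<and>
     is_arg_min (\<lambda>p. s_scale \<rho> K y x n (bt1 p) (bt2 p) p) (\<lambda>p. p \<in> {0..1}) ph"

end

theory Submission
  imports Defs
begin

text \<open>
  The estimated scale is the minimum of \<open>s_scale\<close> over all coefficients in \<open>\<Upsilon>\<close> and all break fractions.
  The claim concerns this minimal value and not where it is attained, so it suffices to bound the scale
  from above at one parameter and from below at all parameters.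

  Upper bound: the minimum is at most the scale at the true parameter, where the residuals are the errors.
  By a strong law, the averages of \<open>\<rho> (\<epsilon> t / s)\<close> tend to the mean loss of a centred normal variable with
  standard deviation \<open>\<sigma>\<^sub>0 / s\<close>, which is below \<open>K\<close> for \<open>s > \<sigma>\<^sub>0\<close>.

  Lower bound: at a wrong parameter the residual on each of at most three segments is
  \<open>\<epsilon> t + X t \<bullet> u\<close> with a fixed \<open>u\<close>.  Noise and regressors are independent, so this is a stationary
  Gaussian sequence whose variance is at least \<open>\<sigma>\<^sub>0\<^sup>2\<close>; as \<open>\<rho>\<close> is even and nondecreasing in the modulus,
  its mean loss is at least that of the noise.  For \<open>s < \<sigma>\<^sub>0\<close> the average loss therefore exceeds \<open>K\<close>
  at all parameters, and every solution of the scale equation lies above \<open>s\<close>.  The uniformity comes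
  from compactness of \<open>\<Upsilon>\<close>, the Lipschitz property of \<open>\<rho>\<close> and the fact that averages that converge are
  controlled on all segments at once (\<open>uniform_segment_lower_bound\<close>).

  The strong law for \<open>Z t = \<epsilon> t + X t \<bullet> u\<close> is obtained from second moments.  For cosines and
  squares of \<open>Z\<close> covariances are computed from the laws of linear combinations of two values, and they are
  bounded by a multiple of the covariance of \<open>Z\<close> (\<open>cos_covariance\<close>, \<open>square_covariance\<close>).  If the double
  sum of the covariances grows at most like \<open>n powr (2 - \<delta>)\<close>, averages converge almost surely
  (\<open>strong_law_covariance\<close>), and the convergence of the empirical characteristic functions turns into weak
  convergence of the empirical measures by Levy's theorem (\<open>empirical_average\<close>).

  It remains to bound these double sums.  The regressor covariances are dominated by a negative power of the
  lag.  The noise covariances involve a slowly varying factor; their sum is bounded by comparing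
  sums of length \<open>2 n\<close> and \<open>n\<close>: splitting into even and odd indices costs a factor 4,
  and doubling the lags gains a factor arbitrarily close to \<open>2 powr (- \<alpha>)\<close> (\<open>lag_sum_power_bound\<close>).
\<close>

section \<open>A strong law for sums with subquadratic variance\<close>

text \<open>
  Consecutive powers \<open>k ^ p\<close> and \<open>(k + 1) ^ p\<close> have ratio tending to one, so a nondecreasing \<open>S\<close>
  cannot move far, relative to its argument, between them.
\<close>

lemma cesaro_from_power_subsequence:
  fixes S :: "nat \<Rightarrow> real"
  assumes mono: "\<And>m n. m \<le> n \<Longrightarrow> S m \<le> S n" and S0: "0 \<le> S 0" and p: "p \<ge> 1"
    and sub: "(\<lambda>k. S (k ^ p) / real (k ^ p)) \<longlonglongrightarrow> \<mu>"
  shows "(\<lambda>n. S n / real n) \<longlonglongrightarrow> \<mu>"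
proof -
  define k where "k = (\<lambda>n::nat. nat \<lfloor>root p (real n)\<rfloor>)"
  have lo: "k n ^ p \<le> n" for n
  proof -
    have "real (k n) \<le> root p (real n)" unfolding k_def by (simp add: real_root_ge_zero)
    then have "real (k n) ^ p \<le> root p (real n) ^ p" by (intro power_mono) auto
    also have "\<dots> = real n" using p by simp
    finally show ?thesis by (metis of_nat_le_iff of_nat_power)
  qed
  have hi: "n \<le> (k n + 1) ^ p" for n
  proof -
    have "root p (real n) \<le> real (k n + 1)" unfolding k_def by linarith
    then have "root p (real n) ^ p \<le> real (k n + 1) ^ p"
      by (intro power_mono real_root_ge_zero) auto
    moreover have "root p (real n) ^ p = real n" using p by simp
    ultimately show ?thesis by (metis of_nat_le_iff of_nat_power)
  qed
  have k_lim: "filterlim k at_top sequentially"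
  proof -
    have "k n \<ge> N" if "n \<ge> N ^ p" for n N
    proof -
      have "root p (real (N ^ p)) \<le> root p (real n)" using that p by (intro real_root_le_mono) (auto simp flip: of_nat_power)
      moreover have "root p (real (N ^ p)) = real N" using p by (simp add: real_root_power_cancel)
      ultimately show ?thesis unfolding k_def by linarith
    qed
    then show ?thesis unfolding filterlim_at_top eventually_sequentially by blast
  qed
  have Spos: "0 \<le> S n" for n using S0 mono[of 0 n] by simp
  have ratio: "(\<lambda>j::nat. (real j / real (j + 1)) ^ p) \<longlonglongrightarrow> 1 ^ p"
    by (intro tendsto_power) (use LIMSEQ_n_over_Suc_n in simp)
  have ratio': "(\<lambda>j::nat. (real (j + 1) / real j) ^ p) \<longlonglongrightarrow> 1 ^ p"
    by (intro tendsto_power) (use LIMSEQ_Suc_n_over_n in simp)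
  have sub1: "(\<lambda>j. S ((j + 1) ^ p) / real ((j + 1) ^ p)) \<longlonglongrightarrow> \<mu>"
    using LIMSEQ_ignore_initial_segment[OF sub, of 1] by simp
  have L: "(\<lambda>n. S (k n ^ p) / real (k n ^ p) * (real (k n) / real (k n + 1)) ^ p) \<longlonglongrightarrow> \<mu>"
    using filterlim_compose[OF tendsto_mult[OF sub ratio] k_lim] by simp
  have U: "(\<lambda>n. S ((k n + 1) ^ p) / real ((k n + 1) ^ p) * (real (k n + 1) / real (k n)) ^ p) \<longlonglongrightarrow> \<mu>"
    using filterlim_compose[OF tendsto_mult[OF sub1 ratio'] k_lim] by simp
  have ev: "\<forall>\<^sub>F n in sequentially. k n \<ge> 1"
    using k_lim by (auto simp: filterlim_at_top)
  show ?thesis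
  proof (rule tendsto_sandwich[OF _ _ L U])
    show "\<forall>\<^sub>F n in sequentially. S (k n ^ p) / real (k n ^ p) * (real (k n) / real (k n + 1)) ^ p \<le> S n / real n"
      using ev
    proof eventually_elim
      case (elim n)
      have n: "n > 0" using lo[of n] elim by (metis One_nat_def Suc_le_eq le_trans one_le_power)
      have "S (k n ^ p) / real (k n ^ p) * (real (k n) / real (k n + 1)) ^ p = S (k n ^ p) / real ((k n + 1) ^ p)"
        using elim by (simp add: power_divide)
      also have "\<dots> \<le> S n / real n"
        using mono[OF lo] hi[of n] n Spos by (intro frac_le) (auto simp flip: of_nat_power)
      finally show ?case .
    qed
    show "\<forall>\<^sub>F n in sequentially. S n / real n \<le> S ((k n + 1) ^ p) / real ((k n + 1) ^ p) * (real (k n + 1) / real (k n)) ^ p"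
      using ev
    proof eventually_elim
      case (elim n)
      have "S n / real n \<le> S ((k n + 1) ^ p) / real (k n ^ p)"
        using mono[OF hi] lo[of n] elim Spos by (intro frac_le) (auto simp flip: of_nat_power)
      also have "\<dots> = S ((k n + 1) ^ p) / real ((k n + 1) ^ p) * (real (k n + 1) / real (k n)) ^ p"
        by (simp add: power_divide)
      finally show ?case .
    qed
  qed
qed

text \<open>
  A variance of order \<open>n powr (2 - \<delta>)\<close> is not summable after division by \<open>n\<^sup>2\<close>, but it is along the
  subsequence \<open>k ^ p\<close> once \<open>p * \<delta> \<ge> 2\<close>.  Nonnegativity makes the partial sums monotone, which fills
  the gaps of that subsequence.
\<close>

lemma (in prob_space) strong_law_nonneg:
  fixes W :: "nat \<Rightarrow> 'a \<Rightarrow> real"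
  assumes meas: "\<And>t. t \<ge> 1 \<Longrightarrow> W t \<in> borel_measurable M"
    and nonneg: "\<And>t \<omega>. t \<ge> 1 \<Longrightarrow> 0 \<le> W t \<omega>"
    and int: "\<And>n. integrable M (\<lambda>\<omega>. ((\<Sum>t=1..n. W t \<omega>) - real n * \<mu>)\<^sup>2)"
    and bound: "\<And>n. n \<ge> 1 \<Longrightarrow>
      expectation (\<lambda>\<omega>. ((\<Sum>t=1..n. W t \<omega>) - real n * \<mu>)\<^sup>2) \<le> C * real n powr (2 - \<delta>)"
    and \<delta>: "\<delta> > 0"
  shows "AE \<omega> in M. (\<lambda>n. (\<Sum>t=1..n. W t \<omega>) / real n) \<longlonglongrightarrow> \<mu>"
proof -
  define p where "p = nat \<lceil>2 / \<delta>\<rceil>"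
  have "2 / \<delta> \<le> real p" unfolding p_def by linarith
  then have p\<delta>: "2 \<le> real p * \<delta>" using \<delta> by (simp add: field_simps)
  have p: "p \<ge> 1" using p\<delta> by (cases p) auto
  \<comment> \<open>squared deviation of the average along the subsequence; the shift avoids the index 0\<close>
  define D where "D = (\<lambda>k \<omega>. ((\<Sum>t=1..(k+1)^p. W t \<omega>) / real ((k+1)^p) - \<mu>)\<^sup>2)"
  have D_meas[measurable]: "D k \<in> borel_measurable M" for k
    unfolding D_def by (intro borel_measurable_power borel_measurable_diff borel_measurable_divide borel_measurable_sum borel_measurable_const meas) auto
  have C: "C \<ge> 0"
  proof -
    have "0 \<le> expectation (\<lambda>\<omega>. ((\<Sum>t=1..1. W t \<omega>) - real 1 * \<mu>)\<^sup>2)" by (intro Bochner_Integration.integral_nonneg) auto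
    also have "\<dots> \<le> C" using bound[of 1] by simp
    finally show ?thesis .
  qed
  have D_eq: "D k \<omega> = ((\<Sum>t=1..(k+1)^p. W t \<omega>) - real ((k+1)^p) * \<mu>)\<^sup>2 / (real ((k+1)^p))\<^sup>2" for k \<omega>
  proof -
    have "(\<Sum>t=1..(k+1)^p. W t \<omega>) / real ((k+1)^p) - \<mu> = ((\<Sum>t=1..(k+1)^p. W t \<omega>) - real ((k+1)^p) * \<mu>) / real ((k+1)^p)"
      by (simp add: field_simps)
    then show ?thesis unfolding D_def by (simp add: power_divide)
  qed
  have ED: "(\<integral>\<^sup>+ \<omega>. ennreal (D k \<omega>) \<partial>M) \<le> ennreal (C * (1 / real (k + 1) ^ 2))" for k
  proof -
    let ?N = "(k+1)^p"
    have intD: "integrable M (D k)" unfolding D_eq by (intro integrable_divide_zero int)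
    have N1: "real (k + 1) \<ge> 1" by simp
    have Npos: "real ?N > 0" by (simp del: of_nat_Suc)
    have "expectation (D k) = expectation (\<lambda>\<omega>. ((\<Sum>t=1..?N. W t \<omega>) - real ?N * \<mu>)\<^sup>2) / (real ?N)\<^sup>2"
      unfolding D_eq by simp
    also have "\<dots> \<le> C * real ?N powr (2 - \<delta>) / (real ?N)\<^sup>2"
      by (intro divide_right_mono bound) auto
    also have "\<dots> = C * real ?N powr (- \<delta>)"
      using Npos by (simp add: powr_diff powr_minus field_simps del: of_nat_power of_nat_Suc)
    also have "real ?N powr (- \<delta>) = real (k+1) powr (- (real p * \<delta>))"
      by (simp add: powr_realpow[symmetric] powr_powr del: of_nat_Suc)
    also have "\<dots> \<le> real (k+1) powr (-2)"
      using p\<delta> N1 by (intro powr_mono) auto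
    also have "\<dots> = 1 / real (k+1) ^ 2"
      by (simp add: powr_minus divide_simps del: of_nat_Suc)
    finally have "expectation (D k) \<le> C * (1 / real (k+1)^2)" using C by (simp add: mult_left_mono)
    moreover have "(\<integral>\<^sup>+ \<omega>. ennreal (D k \<omega>) \<partial>M) = ennreal (expectation (D k))"
      by (rule nn_integral_eq_integral[OF intD]) (simp add: D_def)
    ultimately show ?thesis by (simp add: ennreal_leI)
  qed
  have "summable (\<lambda>k. C * (1 / real (k + 1) ^ 2))"
    using summable_mult[OF summable_ignore_initial_segment[OF inverse_power_summable[of 2], of 1], of C]
    by (simp add: field_simps)
  then have fin: "(\<Sum>k. ennreal (C * (1 / real (k + 1) ^ 2))) < \<infinity>"
    using C by (subst suminf_ennreal2) (auto simp: less_top[symmetric])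
  have "(\<integral>\<^sup>+ \<omega>. (\<Sum>k. ennreal (D k \<omega>)) \<partial>M) = (\<Sum>k. \<integral>\<^sup>+ \<omega>. ennreal (D k \<omega>) \<partial>M)"
    by (intro nn_integral_suminf) auto
  also have "\<dots> \<le> (\<Sum>k. ennreal (C * (1 / real (k + 1) ^ 2)))"
    by (intro suminf_le ED) auto
  finally have "(\<integral>\<^sup>+ \<omega>. (\<Sum>k. ennreal (D k \<omega>)) \<partial>M) \<noteq> \<infinity>" using fin by (auto simp: top_unique)
  then have "AE \<omega> in M. (\<Sum>k. ennreal (D k \<omega>)) \<noteq> \<infinity>"
    by (intro nn_integral_PInf_AE) auto
  then show ?thesis
  proof eventually_elim
    case (elim \<omega>)
    have "summable (\<lambda>k. D k \<omega>)"
      by (rule summable_suminf_not_top) (use elim in \<open>auto simp: D_def\<close>)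
    then have "(\<lambda>k. D k \<omega>) \<longlonglongrightarrow> 0" by (rule summable_LIMSEQ_zero)
    then have "(\<lambda>k. sqrt (D k \<omega>)) \<longlonglongrightarrow> sqrt 0" by (intro tendsto_real_sqrt)
    then have "(\<lambda>k. (\<Sum>t=1..(k+1)^p. W t \<omega>) / real ((k+1)^p) - \<mu>) \<longlonglongrightarrow> 0"
      unfolding D_def by (simp add: tendsto_rabs_zero_iff)
    then have "(\<lambda>k. (\<Sum>t=1..(k+1)^p. W t \<omega>) / real ((k+1)^p)) \<longlonglongrightarrow> \<mu>" by (simp add: LIM_zero_iff)
    then have "(\<lambda>k. (\<Sum>t=1..k^p. W t \<omega>) / real (k^p)) \<longlonglongrightarrow> \<mu>"
      by (rule LIMSEQ_offset[where k=1])
    then show ?case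
      by (intro cesaro_from_power_subsequence[OF _ _ p]) (auto intro!: sum_mono2 nonneg)
  qed
qed

text \<open>
  The form in which the strong law is applied: a lower bound replaces nonnegativity (shift by \<open>B\<close>),
  and the variance of the sum is controlled through a double sum of covariance bounds.
\<close>

lemma (in prob_space) strong_law_covariance:
  fixes W :: "nat \<Rightarrow> 'a \<Rightarrow> real"
  assumes meas: "\<And>t. t \<ge> 1 \<Longrightarrow> W t \<in> borel_measurable M"
    and lower: "\<And>t \<omega>. t \<ge> 1 \<Longrightarrow> - B \<le> W t \<omega>"
    and int: "\<And>s t. s \<ge> 1 \<Longrightarrow> t \<ge> 1 \<Longrightarrow> integrable M (\<lambda>\<omega>. (W s \<omega> - \<mu>) * (W t \<omega> - \<mu>))"
    and cov: "\<And>s t. s \<ge> 1 \<Longrightarrow> t \<ge> 1 \<Longrightarrow>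
      expectation (\<lambda>\<omega>. (W s \<omega> - \<mu>) * (W t \<omega> - \<mu>)) \<le> \<kappa> s t"
    and sum: "\<And>n. n \<ge> 1 \<Longrightarrow> (\<Sum>s=1..n. \<Sum>t=1..n. \<kappa> s t) \<le> C * real n powr (2 - \<delta>)"
    and \<delta>: "\<delta> > 0"
  shows "AE \<omega> in M. (\<lambda>n. (\<Sum>t=1..n. W t \<omega>) / real n) \<longlonglongrightarrow> \<mu>"
proof -
  have centre: "((\<Sum>t=1..n. W t \<omega> + B) - real n * (\<mu> + B))\<^sup>2 =
      (\<Sum>s=1..n. \<Sum>t=1..n. (W s \<omega> - \<mu>) * (W t \<omega> - \<mu>))" for n \<omega>
  proof -
    have "(\<Sum>t=1..n. W t \<omega> + B) - real n * (\<mu> + B) = (\<Sum>t=1..n. W t \<omega> - \<mu>)"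
      by (simp add: sum.distrib sum_subtractf algebra_simps)
    then show ?thesis by (simp add: power2_eq_square sum_product)
  qed
  have "AE \<omega> in M. (\<lambda>n. (\<Sum>t=1..n. W t \<omega> + B) / real n) \<longlonglongrightarrow> \<mu> + B"
  proof (rule strong_law_nonneg[OF _ _ _ _ \<delta>])
    show "(\<lambda>\<omega>. W t \<omega> + B) \<in> borel_measurable M" if "t \<ge> 1" for t
      using meas[OF that] by simp
    show "0 \<le> W t \<omega> + B" if "t \<ge> 1" for t \<omega> using lower[OF that, of \<omega>] by simp
    show "integrable M (\<lambda>\<omega>. ((\<Sum>t=1..n. W t \<omega> + B) - real n * (\<mu> + B))\<^sup>2)" for n
      unfolding centre by (intro Bochner_Integration.integrable_sum int) auto
    show "expectation (\<lambda>\<omega>. ((\<Sum>t=1..n. W t \<omega> + B) - real n * (\<mu> + B))\<^sup>2)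
        \<le> C * real n powr (2 - \<delta>)" if "n \<ge> 1" for n
    proof -
      have "expectation (\<lambda>\<omega>. ((\<Sum>t=1..n. W t \<omega> + B) - real n * (\<mu> + B))\<^sup>2) =
          (\<Sum>s=1..n. \<Sum>t=1..n. expectation (\<lambda>\<omega>. (W s \<omega> - \<mu>) * (W t \<omega> - \<mu>)))"
        unfolding centre
        by (subst Bochner_Integration.integral_sum)
          (auto intro!: Bochner_Integration.integrable_sum int sum.cong Bochner_Integration.integral_sum)
      also have "\<dots> \<le> (\<Sum>s=1..n. \<Sum>t=1..n. \<kappa> s t)" by (intro sum_mono cov) auto
      also have "\<dots> \<le> C * real n powr (2 - \<delta>)" by (rule sum[OF that])
      finally show ?thesis .
    qed
  qed
  then show ?thesis
  proof eventually_elim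
    case (elim \<omega>)
    from tendsto_diff[OF elim tendsto_const[of B]]
    have "(\<lambda>n. (\<Sum>t=1..n. W t \<omega> + B) / real n - B) \<longlonglongrightarrow> \<mu>" by simp
    moreover have "\<forall>\<^sub>F n in sequentially. (\<Sum>t=1..n. W t \<omega> + B) / real n - B = (\<Sum>t=1..n. W t \<omega>) / real n"
      using eventually_gt_at_top[of 0] by eventually_elim (simp add: sum.distrib field_simps)
    ultimately show ?case by (rule Lim_transform_eventually)
  qed
qed

section \<open>Moments of centred Gaussian variables\<close>

text \<open>
  Degenerate variables (\<open>w = 0\<close>) are included, because projections of a Gaussian vector may be
  constant.
\<close>

definition centred_gaussian :: "'a measure \<Rightarrow> real \<Rightarrow> ('a \<Rightarrow> real) \<Rightarrow> bool" where
  "centred_gaussian M w V \<longleftrightarrow>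
     gaussian_rv M V \<and> (\<integral>\<omega>. V \<omega> \<partial>M) = 0 \<and> (\<integral>\<omega>. (V \<omega>)\<^sup>2 \<partial>M) = w"

lemma (in prob_space) centred_gaussian_measurable:
  "centred_gaussian M w V \<Longrightarrow> V \<in> borel_measurable M"
  by (simp add: centred_gaussian_def gaussian_rv_def)

text \<open>
  Writing the law as an image of the standard normal law treats the degenerate and the
  nondegenerate case alike in everything that follows.
\<close>

lemma (in prob_space) centred_gaussian_distr:
  assumes "centred_gaussian M w V"
  shows "distr M borel V = distr std_normal_distribution borel (\<lambda>x. sqrt w * x)"
proof -
  interpret N: real_distribution std_normal_distribution by (rule real_dist_normal_dist)
  have V[measurable]: "V \<in> borel_measurable M" and E: "expectation V = 0"
    and E2: "expectation (\<lambda>\<omega>. (V \<omega>)\<^sup>2) = w"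
    using assms by (auto simp: centred_gaussian_def gaussian_rv_def)
  obtain m s where "s > 0 \<and> distributed M lborel V (normal_density m s) \<or> (AE \<omega> in M. V \<omega> = m)"
    using assms by (auto simp: centred_gaussian_def gaussian_rv_def)
  then show ?thesis
  proof
    assume *: "s > 0 \<and> distributed M lborel V (normal_density m s)"
    then have m: "m = 0" using normal_distributed_expectation[of s V m] E by simp
    have "w = s\<^sup>2" using normal_distributed_variance[of s V m] * E E2 by simp
    then have s: "s = sqrt w" using * by simp
    have "distributed std_normal_distribution lborel (\<lambda>x. x) std_normal_density"
      unfolding distributed_def by (auto simp: distr_id2)
    from N.normal_density_affine[OF this, of s 0] *
    have "distributed std_normal_distribution lborel (\<lambda>x. s * x) (normal_density 0 s)" by auto
    then have "distr std_normal_distribution lborel (\<lambda>x. s * x) = distr M lborel V"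
      using * m by (simp add: distributed_def)
    then have "distr std_normal_distribution borel (\<lambda>x. s * x) = distr M borel V"
      by (metis (no_types, lifting) distr_cong sets_lborel)
    then show ?thesis using s by simp
  next
    assume *: "AE \<omega> in M. V \<omega> = m"
    have "expectation V = expectation (\<lambda>_. m)" by (rule integral_cong_AE) (use * in auto)
    then have m: "m = 0" using E by (simp add: prob_space)
    have "expectation (\<lambda>\<omega>. (V \<omega>)\<^sup>2) = expectation (\<lambda>_. 0)"
      by (rule integral_cong_AE) (use * m in auto)
    then have w: "w = 0" using E2 by simp
    have "distr M borel V = distr M borel (\<lambda>_. 0)"
      by (rule distr_cong_AE) (use * m in auto)
    also have "\<dots> = return borel 0" by (rule distr_const) simp
    also have "\<dots> = distr std_normal_distribution borel (\<lambda>_. 0)" by (rule N.distr_const[symmetric]) simp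
    finally show ?thesis by (simp add: w)
  qed
qed

lemma (in prob_space) centred_gaussian_integral:
  fixes f :: "real \<Rightarrow> real"
  assumes "centred_gaussian M w V" and f[measurable]: "f \<in> borel_measurable borel"
  shows "integrable M (\<lambda>\<omega>. f (V \<omega>)) \<longleftrightarrow> integrable std_normal_distribution (\<lambda>x. f (sqrt w * x))"
    and "expectation (\<lambda>\<omega>. f (V \<omega>)) = (\<integral>x. f (sqrt w * x) \<partial>std_normal_distribution)"
proof -
  have V[measurable]: "V \<in> borel_measurable M"
    using assms by (rule_tac centred_gaussian_measurable)
  show "integrable M (\<lambda>\<omega>. f (V \<omega>)) \<longleftrightarrow> integrable std_normal_distribution (\<lambda>x. f (sqrt w * x))"
    using integrable_distr_eq[of V M borel f] integrable_distr_eq[of "\<lambda>x. sqrt w * x" std_normal_distribution borel f]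
    by (simp add: centred_gaussian_distr[OF assms(1)])
  show "expectation (\<lambda>\<omega>. f (V \<omega>)) = (\<integral>x. f (sqrt w * x) \<partial>std_normal_distribution)"
    using integral_distr[of V M borel f] integral_distr[of "\<lambda>x. sqrt w * x" std_normal_distribution borel f]
    by (simp add: centred_gaussian_distr[OF assms(1)])
qed

lemma std_normal_cos_sin:
  "(\<integral>x. cos (a * x) \<partial>std_normal_distribution) = exp (- a\<^sup>2 / 2)"
  "(\<integral>x. sin (a * x) \<partial>std_normal_distribution) = 0"
proof -
  interpret N: real_distribution std_normal_distribution by (rule real_dist_normal_dist)
  have "integrable std_normal_distribution (\<lambda>x. iexp (a * x))"
    by (rule N.integrable_const_bound[where B=1]) auto
  note 1 = integral_Re[OF this] integral_Im[OF this]
  have "(CLINT x|std_normal_distribution. iexp (a * x)) = complex_of_real (exp (- (a^2) / 2))"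
    using fun_cong[OF char_std_normal_distribution, of a] by (simp add: char_def)
  with 1 show "(\<integral>x. cos (a * x) \<partial>std_normal_distribution) = exp (- a\<^sup>2 / 2)"
    "(\<integral>x. sin (a * x) \<partial>std_normal_distribution) = 0"
    by (simp_all add: Re_exp Im_exp)
qed

lemma (in prob_space) centred_gaussian_var_nonneg:
  "centred_gaussian M w V \<Longrightarrow> w \<ge> 0"
  unfolding centred_gaussian_def by (auto intro: Bochner_Integration.integral_nonneg)

lemma (in prob_space) centred_gaussian_cos:
  assumes "centred_gaussian M w V"
  shows "expectation (\<lambda>\<omega>. cos (V \<omega> + b)) = exp (- w / 2) * cos b"
proof -
  interpret N: real_distribution std_normal_distribution by (rule real_dist_normal_dist)
  have i: "integrable std_normal_distribution (\<lambda>x. cos (sqrt w * x))"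
    "integrable std_normal_distribution (\<lambda>x. sin (sqrt w * x))"
    by (rule N.integrable_const_bound[where B=1]; simp)+
  have "expectation (\<lambda>\<omega>. cos (V \<omega> + b)) = (\<integral>x. cos (sqrt w * x + b) \<partial>std_normal_distribution)"
    by (rule centred_gaussian_integral(2)[OF assms, of "\<lambda>x. cos (x + b)"]) auto
  also have "\<dots> = exp (- w / 2) * cos b"
    using i centred_gaussian_var_nonneg[OF assms] by (simp add: cos_add std_normal_cos_sin)
  finally show ?thesis .
qed

lemma (in prob_space) centred_gaussian_moments:
  assumes "centred_gaussian M w V"
  shows "integrable M V" "integrable M (\<lambda>\<omega>. (V \<omega>)\<^sup>2)" "integrable M (\<lambda>\<omega>. (V \<omega>) ^ 4)"
    "expectation (\<lambda>\<omega>. (V \<omega>) ^ 4) = 3 * w\<^sup>2"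
proof -
  interpret N: real_distribution std_normal_distribution by (rule real_dist_normal_dist)
  have V[measurable]: "V \<in> borel_measurable M"
    using assms by (rule_tac centred_gaussian_measurable)
  have i4: "integrable std_normal_distribution (\<lambda>x. x ^ 4)"
    and e4: "(\<integral>x. x ^ 4 \<partial>std_normal_distribution) = 3"
    using std_normal_distribution_even_moments[of 2] by (auto simp: fact_numeral)
  show I4: "integrable M (\<lambda>\<omega>. (V \<omega>) ^ 4)"
    using centred_gaussian_integral(1)[OF assms, of "\<lambda>x. x^4"] i4 by (simp add: power_mult_distrib)
  show "expectation (\<lambda>\<omega>. (V \<omega>) ^ 4) = 3 * w\<^sup>2"
    using centred_gaussian_integral(2)[OF assms, of "\<lambda>x. x^4"] e4 centred_gaussian_var_nonneg[OF assms]
    by (simp add: power_mult_distrib real_sqrt_power_even)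
  show I2: "integrable M (\<lambda>\<omega>. (V \<omega>)\<^sup>2)"
  proof (rule Bochner_Integration.integrable_bound[of M "\<lambda>\<omega>. 1 + V \<omega> ^ 4"])
    have "x\<^sup>2 \<le> 1 + x ^ 4" for x :: real
      using sum_squares_ge_zero[of "x\<^sup>2 - 1/2" 0] by (simp add: power2_eq_square power4_eq_xxxx algebra_simps)
    then show "AE \<omega> in M. norm ((V \<omega>)\<^sup>2) \<le> norm (1 + V \<omega> ^ 4)" by (auto intro!: AE_I2 simp: abs_of_nonneg add_nonneg_nonneg)
  qed (use I4 in auto)
  show "integrable M V" by (rule square_integrable_imp_integrable[OF V I2])
qed

text \<open>
  Domination: \<open>\<bar>x * y\<bar> \<le> x\<^sup>2 + y\<^sup>2\<close>.
\<close>

lemma integrable_product: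
  fixes U V :: "'a \<Rightarrow> real"
  assumes [measurable]: "U \<in> borel_measurable M" "V \<in> borel_measurable M"
    and i: "integrable M (\<lambda>\<omega>. (U \<omega>)\<^sup>2)" "integrable M (\<lambda>\<omega>. (V \<omega>)\<^sup>2)"
  shows "integrable M (\<lambda>\<omega>. U \<omega> * V \<omega>)"
proof (rule Bochner_Integration.integrable_bound)
  show "integrable M (\<lambda>\<omega>. (U \<omega>)\<^sup>2 + (V \<omega>)\<^sup>2)" using i by simp
  have "\<bar>x * y\<bar> \<le> x\<^sup>2 + y\<^sup>2" for x y :: real
    using sum_squares_bound[of "\<bar>x\<bar>" "\<bar>y\<bar>"] mult_nonneg_nonneg[of "\<bar>x\<bar>" "\<bar>y\<bar>"]
    unfolding abs_mult power2_abs by linarith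
  then show "AE \<omega> in M. norm (U \<omega> * V \<omega>) \<le> norm ((U \<omega>)\<^sup>2 + (V \<omega>)\<^sup>2)"
    by (auto simp: abs_of_nonneg)
qed simp

lemma exp_decrement_bound:
  fixes r v :: real
  assumes "\<bar>r\<bar> \<le> v" shows "exp (- v) * \<bar>exp r - 1\<bar> \<le> \<bar>r\<bar>"
proof (cases "r \<ge> 0")
  case True
  have "exp (- v) * (exp r - 1) \<le> exp (- r) * (exp r - 1)"
    using assms True by (intro mult_right_mono) auto
  also have "\<dots> = 1 - exp (- r)" by (simp add: right_diff_distrib flip: exp_add)
  also have "\<dots> \<le> r" using exp_ge_add_one_self[of "- r"] by linarith
  finally show ?thesis using True by simp
next
  case False
  have "exp (- v) * (1 - exp r) \<le> 1 * (1 - exp r)"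
    using assms False by (intro mult_right_mono) auto
  also have "\<dots> \<le> - r" using exp_ge_add_one_self[of r] by (simp only: mult_1)
  finally show ?thesis using False by simp
qed

section \<open>Covariances of cosines and squares of Gaussian sequences\<close>

text \<open>
  Products of cosines and products of squares are sums of functions of single linear combinations of
  \<open>Z s\<close> and \<open>Z t\<close>.  The covariance inequalities below therefore follow from one-dimensional Gaussian laws.
\<close>

locale gaussian_pairs = prob_space M for M :: "'a measure" +
  fixes Z :: "nat \<Rightarrow> 'a \<Rightarrow> real" and v :: real
  assumes gauss: "\<And>s t a b. s \<ge> 1 \<Longrightarrow> t \<ge> 1 \<Longrightarrow> gaussian_rv M (\<lambda>\<omega>. a * Z s \<omega> + b * Z t \<omega>)"
    and mean: "\<And>t. t \<ge> 1 \<Longrightarrow> expectation (Z t) = 0"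
    and var: "\<And>t. t \<ge> 1 \<Longrightarrow> expectation (\<lambda>\<omega>. (Z t \<omega>)\<^sup>2) = v"
begin

definition pair_cov where "pair_cov s t = expectation (\<lambda>\<omega>. Z s \<omega> * Z t \<omega>)"

lemma marginal: "t \<ge> 1 \<Longrightarrow> centred_gaussian M v (Z t)"
  using gauss[of t t 1 0] mean[of t] var[of t] by (simp add: centred_gaussian_def)

lemma meas: "t \<ge> 1 \<Longrightarrow> Z t \<in> borel_measurable M"
  using marginal centred_gaussian_measurable by blast

lemma prod_integrable: "s \<ge> 1 \<Longrightarrow> t \<ge> 1 \<Longrightarrow> integrable M (\<lambda>\<omega>. Z s \<omega> * Z t \<omega>)"
  by (intro integrable_product meas centred_gaussian_moments(2)[OF marginal])

lemma combination:
  assumes "s \<ge> 1" "t \<ge> 1"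
  shows "centred_gaussian M (a\<^sup>2 * v + b\<^sup>2 * v + 2 * a * b * pair_cov s t) (\<lambda>\<omega>. a * Z s \<omega> + b * Z t \<omega>)"
proof -
  note i = centred_gaussian_moments[OF marginal[OF assms(1)]] centred_gaussian_moments[OF marginal[OF assms(2)]]
    prod_integrable[OF assms]
  have "expectation (\<lambda>\<omega>. (a * Z s \<omega> + b * Z t \<omega>)\<^sup>2) =
      expectation (\<lambda>\<omega>. a\<^sup>2 * (Z s \<omega>)\<^sup>2 + b\<^sup>2 * (Z t \<omega>)\<^sup>2 + 2 * a * b * (Z s \<omega> * Z t \<omega>))"
    by (simp add: power2_eq_square algebra_simps)
  also have "\<dots> = a\<^sup>2 * v + b\<^sup>2 * v + 2 * a * b * pair_cov s t"
    using i var assms by (simp add: pair_cov_def)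
  finally show ?thesis
    using gauss[OF assms, of a b] i mean assms by (simp add: centred_gaussian_def)
qed

lemma pair_cov_bound: assumes "s \<ge> 1" "t \<ge> 1" shows "\<bar>pair_cov s t\<bar> \<le> v"
  using centred_gaussian_var_nonneg[OF combination[OF assms, of 1 1]]
    centred_gaussian_var_nonneg[OF combination[OF assms, of 1 "-1"]] by simp

text \<open>
  By the product formula for cosines the covariance is
  \<open>exp (- a\<^sup>2 v) * (cos (2 b) * (exp (- a\<^sup>2 \<rho>) - 1) + (exp (a\<^sup>2 \<rho>) - 1)) / 2\<close> with \<open>\<rho> = pair_cov s t\<close>,
  which is at most \<open>a\<^sup>2 * \<bar>\<rho>\<bar>\<close> because \<open>\<bar>\<rho>\<bar> \<le> v\<close>.
\<close>

lemma cos_covariance: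
  fixes a b :: real
  assumes "s \<ge> 1" "t \<ge> 1"
  defines "m \<equiv> exp (- a\<^sup>2 * v / 2) * cos b"
  shows "expectation (\<lambda>\<omega>. (cos (a * Z s \<omega> + b) - m) * (cos (a * Z t \<omega> + b) - m)) \<le> a\<^sup>2 * \<bar>pair_cov s t\<bar>"
proof -
  note [measurable] = meas[OF assms(1)] meas[OF assms(2)]
  have bi: "integrable M (\<lambda>\<omega>. cos (f \<omega>))" if "f \<in> borel_measurable M" for f :: "'a \<Rightarrow> real"
  proof (rule integrable_const_bound[where B=1])
    show "AE \<omega> in M. norm (cos (f \<omega>)) \<le> 1" by simp
    show "(\<lambda>\<omega>. cos (f \<omega>)) \<in> borel_measurable M" using that by measurable
  qed
  have "centred_gaussian M (a\<^sup>2 * v) (\<lambda>\<omega>. a * Z s \<omega>)"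
    using combination[OF assms(1,1), of a 0] by simp
  note c1 = centred_gaussian_cos[OF this, of b]
  have "centred_gaussian M (a\<^sup>2 * v) (\<lambda>\<omega>. a * Z t \<omega>)"
    using combination[OF assms(2,2), of a 0] by simp
  note c2 = centred_gaussian_cos[OF this, of b]
  have c3: "expectation (\<lambda>\<omega>. cos ((a * Z s \<omega> + a * Z t \<omega>) + 2 * b)) = exp (- (a\<^sup>2 * v)) * exp (- (a\<^sup>2 * pair_cov s t)) * cos (2 * b)"
  proof -
    have "- (a\<^sup>2 * v + a\<^sup>2 * v + 2 * a * a * pair_cov s t) / 2 = - (a\<^sup>2 * v) + - (a\<^sup>2 * pair_cov s t)"
      by (simp add: power2_eq_square)
    then show ?thesis
      unfolding centred_gaussian_cos[OF combination[OF assms(1,2), of a a], of "2 * b"]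
      by (simp only: exp_add)
  qed
  have c4: "expectation (\<lambda>\<omega>. cos ((a * Z s \<omega> + (- a) * Z t \<omega>) + 0)) = exp (- (a\<^sup>2 * v)) * exp (a\<^sup>2 * pair_cov s t)"
  proof -
    have "- (a\<^sup>2 * v + (- a)\<^sup>2 * v + 2 * a * (- a) * pair_cov s t) / 2 = - (a\<^sup>2 * v) + a\<^sup>2 * pair_cov s t"
      by (simp add: power2_eq_square)
    then show ?thesis
      unfolding centred_gaussian_cos[OF combination[OF assms(1,2), of a "- a"], of 0]
      by (simp only: exp_add cos_zero mult_1_right)
  qed
  define C1 where "C1 = (\<lambda>\<omega>. cos ((a * Z s \<omega> + a * Z t \<omega>) + 2 * b))"
  define C2 where "C2 = (\<lambda>\<omega>. cos ((a * Z s \<omega> + (- a) * Z t \<omega>) + 0))"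
  define D1 where "D1 = (\<lambda>\<omega>. cos (a * Z s \<omega> + b))"
  define D2 where "D2 = (\<lambda>\<omega>. cos (a * Z t \<omega> + b))"
  have ints: "integrable M C1" "integrable M C2" "integrable M D1" "integrable M D2"
    unfolding C1_def C2_def D1_def D2_def by (rule bi; measurable)+
  have D: "expectation D1 = m" "expectation D2 = m"
    using c1 c2 by (simp_all add: D1_def D2_def m_def)
  have prod: "D1 \<omega> * D2 \<omega> = C1 \<omega> / 2 + C2 \<omega> / 2" for \<omega>
  proof -
    have "C1 \<omega> = cos ((a * Z s \<omega> + b) + (a * Z t \<omega> + b))"
      unfolding C1_def by (rule arg_cong[where f=cos]) simp
    moreover have "C2 \<omega> = cos ((a * Z s \<omega> + b) - (a * Z t \<omega> + b))"
      unfolding C2_def by (rule arg_cong[where f=cos]) simp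
    ultimately show ?thesis
      unfolding D1_def D2_def by (simp only: cos_times_cos add_divide_distrib add.commute)
  qed
  have "expectation (\<lambda>\<omega>. (D1 \<omega> - m) * (D2 \<omega> - m)) =
      expectation (\<lambda>\<omega>. C1 \<omega> / 2 + C2 \<omega> / 2 - m * D1 \<omega> - m * D2 \<omega> + m\<^sup>2)"
    by (rule Bochner_Integration.integral_cong[OF refl])
      (simp add: prod[symmetric] algebra_simps power2_eq_square)
  also have "\<dots> = expectation C1 / 2 + expectation C2 / 2 - m * m - m * m + m\<^sup>2"
    using ints D by (simp add: prob_space)
  also have "\<dots> = exp (- (a\<^sup>2 * v)) * exp (- (a\<^sup>2 * pair_cov s t)) * cos (2 * b) / 2 + exp (- (a\<^sup>2 * v)) * exp (a\<^sup>2 * pair_cov s t) / 2 - m\<^sup>2"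
    using c3 c4 unfolding C1_def C2_def by (simp add: power2_eq_square)
  also have "m\<^sup>2 = exp (- (a\<^sup>2 * v)) * (1 + cos (2 * b)) / 2"
  proof -
    have "(exp (- a\<^sup>2 * v / 2))\<^sup>2 = exp (- (a\<^sup>2 * v))"
      by (simp flip: exp_double)
    then show ?thesis unfolding m_def power_mult_distrib by (simp add: cos_double_cos)
  qed
  also have "exp (- (a\<^sup>2 * v)) * exp (- (a\<^sup>2 * pair_cov s t)) * cos (2 * b) / 2 + exp (- (a\<^sup>2 * v)) * exp (a\<^sup>2 * pair_cov s t) / 2 -
      exp (- (a\<^sup>2 * v)) * (1 + cos (2 * b)) / 2 =
      (exp (- (a\<^sup>2 * v)) * (exp (- (a\<^sup>2 * pair_cov s t)) - 1)) * cos (2 * b) / 2 + (exp (- (a\<^sup>2 * v)) * (exp (a\<^sup>2 * pair_cov s t) - 1)) / 2"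
    (is "?E * ?P * ?c / 2 + ?E * ?Q / 2 - ?E * (1 + ?c) / 2 = _")
  proof -
    have "E * P * c / 2 + E * Q / 2 - E * (1 + c) / 2 = (E * (P - 1)) * c / 2 + (E * (Q - 1)) / 2"
      for E P Q c :: real by (simp add: field_simps)
    then show ?thesis .
  qed
  also have "\<dots> \<le> \<bar>a\<^sup>2 * pair_cov s t\<bar> / 2 + \<bar>a\<^sup>2 * pair_cov s t\<bar> / 2"
  proof -
    have le: "\<bar>a\<^sup>2 * pair_cov s t\<bar> \<le> a\<^sup>2 * v" using pair_cov_bound[OF assms(1,2)] by (simp add: abs_mult mult_left_mono)
    have e1: "\<bar>exp (- (a\<^sup>2 * v)) * (exp (- (a\<^sup>2 * pair_cov s t)) - 1)\<bar> \<le> \<bar>a\<^sup>2 * pair_cov s t\<bar>"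
      using exp_decrement_bound[of "- (a\<^sup>2 * pair_cov s t)" "a\<^sup>2 * v"] le by (simp add: abs_mult)
    have e2: "exp (- (a\<^sup>2 * v)) * (exp (a\<^sup>2 * pair_cov s t) - 1) \<le> \<bar>a\<^sup>2 * pair_cov s t\<bar>"
    proof -
      have "exp (- (a\<^sup>2 * v)) * (exp (a\<^sup>2 * pair_cov s t) - 1) \<le> exp (- (a\<^sup>2 * v)) * \<bar>exp (a\<^sup>2 * pair_cov s t) - 1\<bar>"
        by (rule mult_left_mono[OF abs_ge_self exp_ge_zero])
      also have "\<dots> \<le> \<bar>a\<^sup>2 * pair_cov s t\<bar>" by (rule exp_decrement_bound[OF le])
      finally show ?thesis .
    qed
    have "(exp (- (a\<^sup>2 * v)) * (exp (- (a\<^sup>2 * pair_cov s t)) - 1)) * cos (2 * b) \<le>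
       \<bar>exp (- (a\<^sup>2 * v)) * (exp (- (a\<^sup>2 * pair_cov s t)) - 1)\<bar> * \<bar>cos (2 * b)\<bar>"
      by (metis (no_types) abs_ge_self abs_mult)
    also have "\<dots> \<le> \<bar>a\<^sup>2 * pair_cov s t\<bar> * 1" by (intro mult_mono e1) auto
    finally show ?thesis using e2 by simp
  qed
  also have "\<dots> = a\<^sup>2 * \<bar>pair_cov s t\<bar>" by (simp add: abs_mult)
  finally show ?thesis unfolding D1_def D2_def .
qed

lemma fourth_integrable: "s \<ge> 1 \<Longrightarrow> t \<ge> 1 \<Longrightarrow> integrable M (\<lambda>\<omega>. (Z s \<omega>)\<^sup>2 * (Z t \<omega>)\<^sup>2)"
  by (intro integrable_product borel_measurable_power meas)
    (simp_all add: centred_gaussian_moments(3)[OF marginal] flip: power_mult)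

text \<open>
  Polarisation, \<open>12 x\<^sup>2 y\<^sup>2 = (x + y) ^ 4 + (x - y) ^ 4 - 2 x ^ 4 - 2 y ^ 4\<close>, and the Gaussian fourth
  moment give the exact value \<open>2 (pair_cov s t)\<^sup>2\<close>; one factor is then bounded by \<open>v\<close>.
\<close>

lemma square_covariance:
  assumes "s \<ge> 1" "t \<ge> 1"
  shows "expectation (\<lambda>\<omega>. ((Z s \<omega>)\<^sup>2 - v) * ((Z t \<omega>)\<^sup>2 - v)) \<le> 2 * v * \<bar>pair_cov s t\<bar>"
proof -
  note g = centred_gaussian_moments[OF combination[OF assms, of 1 1], simplified]
    centred_gaussian_moments[OF combination[OF assms, of 1 "-1"], simplified]
    centred_gaussian_moments[OF marginal[OF assms(1)]] centred_gaussian_moments[OF marginal[OF assms(2)]]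
  have "(\<lambda>\<omega>. ((Z s \<omega>)\<^sup>2 - v) * ((Z t \<omega>)\<^sup>2 - v)) =
    (\<lambda>\<omega>. ((Z s \<omega> + Z t \<omega>) ^ 4 + (Z s \<omega> - Z t \<omega>) ^ 4 - 2 * Z s \<omega> ^ 4 - 2 * Z t \<omega> ^ 4) / 12
       - v * (Z s \<omega>)\<^sup>2 - v * (Z t \<omega>)\<^sup>2 + v\<^sup>2)"
    by (rule ext) (simp add: power4_eq_xxxx power2_eq_square algebra_simps)
  then have "expectation (\<lambda>\<omega>. ((Z s \<omega>)\<^sup>2 - v) * ((Z t \<omega>)\<^sup>2 - v)) = 2 * (pair_cov s t)\<^sup>2"
    using g var assms
    by (simp add: prob_space) (simp add: power2_eq_square algebra_simps)
  also have "\<dots> = 2 * \<bar>pair_cov s t\<bar> * \<bar>pair_cov s t\<bar>" by (simp add: power2_eq_square)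
  also have "\<dots> \<le> 2 * v * \<bar>pair_cov s t\<bar>" using pair_cov_bound[OF assms] by (intro mult_right_mono) auto
  finally show ?thesis .
qed

end

text \<open>
  Long-range dependence allows \<open>\<delta> < 1\<close>, so the covariances need not be summable; any gain over
  the trivial order \<open>n\<^sup>2\<close> suffices for the strong law.
\<close>

locale decorrelating_pairs = gaussian_pairs +
  fixes C \<delta> :: real
  assumes decay: "\<And>n. n \<ge> 1 \<Longrightarrow> (\<Sum>s=1..n. \<Sum>t=1..n. \<bar>pair_cov s t\<bar>) \<le> C * real n powr (2 - \<delta>)"
    and \<delta>_pos: "\<delta> > 0"
begin

lemma cos_average:
  "AE \<omega> in M. (\<lambda>n. (\<Sum>t=1..n. cos (a * Z t \<omega> + b)) / real n) \<longlonglongrightarrow> exp (- a\<^sup>2 * v / 2) * cos b"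
proof (rule strong_law_covariance[where B=1 and \<kappa>="\<lambda>s t. a\<^sup>2 * \<bar>pair_cov s t\<bar>" and C="a\<^sup>2 * C" and \<delta>=\<delta>])
  let ?m = "exp (- a\<^sup>2 * v / 2) * cos b"
  show ms: "(\<lambda>\<omega>. cos (a * Z t \<omega> + b)) \<in> borel_measurable M" if "t \<ge> 1" for t
    using meas[OF that] by measurable
  show "integrable M (\<lambda>\<omega>. (cos (a * Z s \<omega> + b) - ?m) * (cos (a * Z t \<omega> + b) - ?m))"
    if "s \<ge> 1" "t \<ge> 1" for s t
  proof (rule integrable_const_bound[where B="(1 + \<bar>?m\<bar>) * (1 + \<bar>?m\<bar>)"])
    have "\<bar>cos x - ?m\<bar> \<le> 1 + \<bar>?m\<bar>" for x
      by (rule order_trans[OF abs_triangle_ineq4]) simp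
    then show "AE \<omega> in M. norm ((cos (a * Z s \<omega> + b) - ?m) * (cos (a * Z t \<omega> + b) - ?m)) \<le> (1 + \<bar>?m\<bar>) * (1 + \<bar>?m\<bar>)"
      unfolding real_norm_def abs_mult[of "_ - _"] by (intro AE_I2 mult_mono) auto
    show "(\<lambda>\<omega>. (cos (a * Z s \<omega> + b) - ?m) * (cos (a * Z t \<omega> + b) - ?m)) \<in> borel_measurable M"
      by (intro borel_measurable_times borel_measurable_diff ms borel_measurable_const that)
  qed
  show "(\<Sum>s=1..n. \<Sum>t=1..n. a\<^sup>2 * \<bar>pair_cov s t\<bar>) \<le> a\<^sup>2 * C * real n powr (2 - \<delta>)" if "n \<ge> 1" for n
    using mult_left_mono[OF decay[OF that], of "a\<^sup>2"] by (simp add: sum_distrib_left mult.assoc)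
qed (use cos_covariance \<delta>_pos in auto)

lemma square_average:
  "AE \<omega> in M. (\<lambda>n. (\<Sum>t=1..n. (Z t \<omega>)\<^sup>2) / real n) \<longlonglongrightarrow> v"
proof (rule strong_law_covariance[where B=0 and \<kappa>="\<lambda>s t. 2 * v * \<bar>pair_cov s t\<bar>" and C="2 * v * C" and \<delta>=\<delta>])
  have v: "v \<ge> 0" using centred_gaussian_var_nonneg[OF marginal[of 1]] by simp
  show "(\<lambda>\<omega>. (Z t \<omega>)\<^sup>2) \<in> borel_measurable M" if "t \<ge> 1" for t
    using meas[OF that] by measurable
  show "integrable M (\<lambda>\<omega>. ((Z s \<omega>)\<^sup>2 - v) * ((Z t \<omega>)\<^sup>2 - v))" if "s \<ge> 1" "t \<ge> 1" for s t
  proof -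
    have "(\<lambda>\<omega>. ((Z s \<omega>)\<^sup>2 - v) * ((Z t \<omega>)\<^sup>2 - v)) =
        (\<lambda>\<omega>. (Z s \<omega>)\<^sup>2 * (Z t \<omega>)\<^sup>2 - v * (Z t \<omega>)\<^sup>2 - v * (Z s \<omega>)\<^sup>2 + v\<^sup>2)"
      by (rule ext) (simp add: algebra_simps power2_eq_square)
    then show ?thesis
      using fourth_integrable[OF that] centred_gaussian_moments(2)[OF marginal] that by simp
  qed
  show "(\<Sum>s=1..n. \<Sum>t=1..n. 2 * v * \<bar>pair_cov s t\<bar>) \<le> 2 * v * C * real n powr (2 - \<delta>)" if "n \<ge> 1" for n
    using mult_left_mono[OF decay[OF that], of "2 * v"] v by (simp add: sum_distrib_left mult.assoc)
qed (use square_covariance \<delta>_pos in auto)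

end

section \<open>Empirical measures of Gaussian sequences\<close>

lemma cos_lipschitz: "\<bar>cos x - cos y\<bar> \<le> \<bar>x - y\<bar>" for x y :: real
proof -
  have "\<bar>cos x - cos y\<bar> = 2 * (\<bar>sin ((x + y) / 2)\<bar> * \<bar>sin ((y - x) / 2)\<bar>)"
    by (simp add: cos_diff_cos abs_mult)
  also have "\<dots> \<le> 2 * (1 * \<bar>(y - x) / 2\<bar>)"
    by (intro mult_left_mono mult_mono abs_sin_x_le_abs_x) auto
  finally show ?thesis by simp
qed

lemma equilipschitz_convergence_from_rationals:
  fixes f :: "nat \<Rightarrow> real \<Rightarrow> real" and B :: real
  assumes lip: "\<And>n x y. \<bar>f n x - f n y\<bar> \<le> B * \<bar>x - y\<bar>"
    and g: "isCont g a"
    and conv: "\<And>q. q \<in> \<rat> \<Longrightarrow> (\<lambda>n. f n q) \<longlonglongrightarrow> g q"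
  shows "(\<lambda>n. f n a) \<longlonglongrightarrow> g a"
proof (rule LIMSEQ_I)
  fix e :: real assume e: "e > 0"
  obtain d where d: "d > 0" "\<And>x. \<bar>x - a\<bar> < d \<Longrightarrow> \<bar>g x - g a\<bar> < e / 3"
    using g e unfolding continuous_at_eps_delta dist_real_def by (metis divide_pos_pos zero_less_numeral)
  define d' where "d' = min d (e / (3 * (\<bar>B\<bar> + 1)))"
  have "d' > 0" using d e by (simp add: d'_def)
  then obtain q where q: "q \<in> \<rat>" "a < q" "q < a + d'" using Rats_dense_in_real[of a "a + d'"] by auto
  have 1: "\<bar>g q - g a\<bar> < e / 3" using q by (intro d) (auto simp: d'_def)
  have 2: "\<bar>f n a - f n q\<bar> < e / 3" for n
  proof -
    have "\<bar>f n a - f n q\<bar> \<le> (\<bar>B\<bar> + 1) * \<bar>a - q\<bar>"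
      by (rule order_trans[OF lip]) (intro mult_right_mono; simp)
    also have "\<dots> < (\<bar>B\<bar> + 1) * (e / (3 * (\<bar>B\<bar> + 1)))"
      using q by (intro mult_strict_left_mono) (auto simp: d'_def)
    also have "\<dots> = e / 3" by (simp add: field_simps)
    finally show ?thesis .
  qed
  obtain N where N: "\<And>n. n \<ge> N \<Longrightarrow> \<bar>f n q - g q\<bar> < e / 3"
    using LIMSEQ_D[OF conv[OF q(1)], of "e / 3"] e by auto
  have "norm (f n a - g a) < e" if "n \<ge> N" for n
    using 1 2[of n] N[OF that] unfolding real_norm_def by linarith
  then show "\<exists>N. \<forall>n\<ge>N. norm (f n a - g a) < e" by blast
qed

lemma average_bound_from_squares:
  fixes z :: "nat \<Rightarrow> real"
  assumes "(\<lambda>n. (\<Sum>t=1..n. (z t)\<^sup>2) / real n) \<longlonglongrightarrow> v"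
  obtains B where "B > 0" "\<And>n. (\<Sum>t=1..n. \<bar>z t\<bar>) \<le> B * real n"
proof -
  have "Bseq (\<lambda>n. (\<Sum>t=1..n. (z t)\<^sup>2) / real n)"
    using assms by (intro convergent_imp_Bseq convergentI)
  then obtain K where K: "K > 0" "\<And>n. norm ((\<Sum>t=1..n. (z t)\<^sup>2) / real n) \<le> K"
    by (auto elim: BseqE)
  have "(\<Sum>t=1..n. \<bar>z t\<bar>) \<le> (1 + K) * real n" for n
  proof (cases "n = 0")
    case False
    have "\<bar>x\<bar> \<le> 1 + x\<^sup>2" for x :: real
      using sum_squares_bound[of "\<bar>x\<bar>" 1] by (simp add: abs_if split: if_splits) 
    then have "(\<Sum>t=1..n. \<bar>z t\<bar>) \<le> (\<Sum>t=1..n. 1 + (z t)\<^sup>2)" by (intro sum_mono)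
    also have "\<dots> = real n + (\<Sum>t=1..n. (z t)\<^sup>2)" by (simp add: sum.distrib)
    also have "(\<Sum>t=1..n. (z t)\<^sup>2) \<le> K * real n"
      using K(2)[of n] False by (simp add: field_simps sum_nonneg)
    finally show ?thesis by (simp add: algebra_simps)
  qed simp
  then show ?thesis using K by (intro that[of "1 + K"]) auto
qed

text \<open>
  Levy's continuity theorem for the empirical measures of the path \<open>z\<close>.  Only countably many
  frequencies can be handled almost surely; the bound on the averages of \<open>\<bar>z t\<bar>\<close> makes the empirical
  characteristic functions uniformly Lipschitz, which extends the convergence to all frequencies.
  The two phases encode the real part (\<open>b = 0\<close>) and the imaginary part
  (\<open>b = - pi / 2\<close>, as \<open>cos (x - pi / 2) = sin x\<close>).
\<close>

lemma empirical_measure_converges_to_normal: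
  fixes z :: "nat \<Rightarrow> real" and f :: "real \<Rightarrow> real"
  assumes cos: "\<And>q b. q \<in> \<rat> \<Longrightarrow> b \<in> {0, - pi / 2} \<Longrightarrow>
      (\<lambda>n. (\<Sum>t=1..n. cos (q * z t + b)) / real n) \<longlonglongrightarrow> exp (- q\<^sup>2 * v / 2) * cos b"
    and sq: "(\<lambda>n. (\<Sum>t=1..n. (z t)\<^sup>2) / real n) \<longlonglongrightarrow> v"
    and f: "\<And>x. isCont f x" "\<And>x. \<bar>f x\<bar> \<le> F"
  shows "(\<lambda>n. (\<Sum>t=1..n. f (z t)) / real n) \<longlonglongrightarrow> (\<integral>x. f (sqrt v * x) \<partial>std_normal_distribution)"
proof -
  have v: "v \<ge> 0" using sq by (rule LIMSEQ_le_const) (auto intro!: sum_nonneg divide_nonneg_nonneg)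
  obtain B where B: "\<And>n. (\<Sum>t=1..n. \<bar>z t\<bar>) \<le> B * real n" and "B > 0"
    using average_bound_from_squares[OF sq] by blast
  have cos': "(\<lambda>n. (\<Sum>t=1..n. cos (a * z t + b)) / real n) \<longlonglongrightarrow> exp (- a\<^sup>2 * v / 2) * cos b"
    if b: "b \<in> {0, - pi / 2}" for a b
  proof (rule equilipschitz_convergence_from_rationals[where B=B
        and f="\<lambda>n a. (\<Sum>t=1..n. cos (a * z t + b)) / real n"
        and g="\<lambda>a. exp (- a\<^sup>2 * v / 2) * cos b"])
    fix n and x y :: real
    show "\<bar>(\<Sum>t=1..n. cos (x * z t + b)) / real n - (\<Sum>t=1..n. cos (y * z t + b)) / real n\<bar> \<le> B * \<bar>x - y\<bar>"
    proof (cases "n = 0")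
      case False
      have "\<bar>(\<Sum>t=1..n. cos (x * z t + b)) - (\<Sum>t=1..n. cos (y * z t + b))\<bar>
          \<le> (\<Sum>t=1..n. \<bar>cos (x * z t + b) - cos (y * z t + b)\<bar>)"
        unfolding sum_subtractf[symmetric] by (rule sum_abs)
      also have "\<dots> \<le> (\<Sum>t=1..n. \<bar>x - y\<bar> * \<bar>z t\<bar>)"
      proof (rule sum_mono)
        fix t
        have "\<bar>cos (x * z t + b) - cos (y * z t + b)\<bar> \<le> \<bar>(x * z t + b) - (y * z t + b)\<bar>"
          by (rule cos_lipschitz)
        also have "(x * z t + b) - (y * z t + b) = (x - y) * z t" by (simp add: algebra_simps)
        finally show "\<bar>cos (x * z t + b) - cos (y * z t + b)\<bar> \<le> \<bar>x - y\<bar> * \<bar>z t\<bar>"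
          by (simp add: abs_mult)
      qed
      also have "\<dots> \<le> \<bar>x - y\<bar> * (B * real n)"
        unfolding sum_distrib_left[symmetric] by (intro mult_left_mono B) auto
      finally show ?thesis using False
        by (simp add: diff_divide_distrib[symmetric] field_simps)
    qed (use \<open>B > 0\<close> in simp)
  qed (use cos b in \<open>auto intro!: continuous_intros\<close>)
  define E where "E n = distr (measure_pmf (pmf_of_set {1..Suc n})) borel z" for n
  define N where "N = distr std_normal_distribution borel (\<lambda>x. sqrt v * x)"
  interpret S: real_distribution std_normal_distribution by (rule real_dist_normal_dist)
  have E: "real_distribution (E n)" for n
    unfolding E_def by (rule prob_space.real_distribution_distr[OF prob_space_measure_pmf]) simp
  have N: "real_distribution N" unfolding N_def by (rule S.real_distribution_distr) simp
  have int_E: "(\<integral>x. h x \<partial>E n) = (\<Sum>t=1..Suc n. h (z t)) / real (Suc n)"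
    if [measurable]: "h \<in> borel_measurable borel" for h :: "real \<Rightarrow> real" and n
    unfolding E_def by (subst integral_distr) (auto simp: integral_pmf_of_set)
  have lim: "weak_conv_m E N"
  proof (rule levy_continuity[OF E N])
    fix a
    have "char N a = char std_normal_distribution (a * sqrt v)"
      unfolding N_def char_def by (subst integral_distr) (auto simp: ac_simps)
    also have "\<dots> = Complex (exp (- a\<^sup>2 * v / 2) * cos 0) (exp (- a\<^sup>2 * v / 2) * cos (- pi / 2))"
      using v by (simp add: char_std_normal_distribution power_mult_distrib complex_eq_iff)
    finally have cN: "char N a = Complex (exp (- a\<^sup>2 * v / 2) * cos 0) (exp (- a\<^sup>2 * v / 2) * cos (- pi / 2))" .
    have cE: "char (E n) a = Complex ((\<Sum>t=1..Suc n. cos (a * z t + 0)) / real (Suc n))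
        ((\<Sum>t=1..Suc n. cos (a * z t + - pi / 2)) / real (Suc n))" for n
    proof -
      interpret En: real_distribution "E n" by (rule E)
      have i: "integrable (E n) (\<lambda>x. iexp (a * x))"
        by (rule En.integrable_const_bound[where B=1]) (auto simp: E_def)
      have "Re (char (E n) a) = (\<integral>x. cos (a * x + 0) \<partial>E n)"
        unfolding char_def using integral_Re[OF i] by (simp add: Re_exp)
      moreover have "cos (a * x + - pi / 2) = sin (a * x)" for x by (simp add: cos_diff)
      then have "Im (char (E n) a) = (\<integral>x. cos (a * x + - pi / 2) \<partial>E n)"
        unfolding char_def using integral_Im[OF i] by (simp add: Im_exp)
      ultimately show ?thesis
        using int_E[of "\<lambda>x. cos (a * x + 0)" n] int_E[of "\<lambda>x. cos (a * x + - pi / 2)" n]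
        by (simp add: complex_eq_iff)
    qed
    show "(\<lambda>n. char (E n) a) \<longlonglongrightarrow> char N a"
      unfolding cN cE by (intro tendsto_Complex cos'[THEN LIMSEQ_Suc]) auto
  qed
  have fm[measurable]: "f \<in> borel_measurable borel"
    using f(1) by (intro borel_measurable_continuous_onI continuous_at_imp_continuous_on) auto
  have "(\<lambda>n. \<integral>x. f x \<partial>E n) \<longlonglongrightarrow> (\<integral>x. f x \<partial>N)"
    by (rule weak_conv_imp_integral_bdd_continuous_conv[OF E N lim, where B=F]) (use f in auto)
  then have "(\<lambda>n. (\<Sum>t=1..Suc n. f (z t)) / real (Suc n)) \<longlonglongrightarrow> (\<integral>x. f (sqrt v * x) \<partial>std_normal_distribution)"
    unfolding int_E[OF fm] N_def by (subst (asm) integral_distr) auto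
  then show ?thesis by (rule LIMSEQ_imp_Suc)
qed

text \<open>
  The exceptional null set is the same for all bounded continuous \<open>f\<close>.
\<close>

lemma (in decorrelating_pairs) empirical_average:
  "AE \<omega> in M. \<forall>f F. (\<forall>x. isCont f x) \<longrightarrow> (\<forall>x. \<bar>f x\<bar> \<le> F) \<longrightarrow>
     (\<lambda>n. (\<Sum>t=1..n. f (Z t \<omega>)) / real n) \<longlonglongrightarrow> (\<integral>x. f (sqrt v * x) \<partial>std_normal_distribution)"
proof -
  have "AE \<omega> in M. \<forall>q\<in>\<rat>. \<forall>b\<in>{0, - pi / 2}.
      (\<lambda>n. (\<Sum>t=1..n. cos (q * Z t \<omega> + b)) / real n) \<longlonglongrightarrow> exp (- q\<^sup>2 * v / 2) * cos b"
    by (intro AE_ball_countable[THEN iffD2] ballI cos_average countable_rat countable_finite) auto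
  then show ?thesis using square_average
  proof eventually_elim
    case (elim \<omega>)
    then show ?case by (intro allI impI empirical_measure_converges_to_normal) auto
  qed
qed

section \<open>Double sums of covariances\<close>

text \<open>
  The distance of two indices, written with truncated subtraction.
\<close>

definition lag :: "nat \<Rightarrow> nat \<Rightarrow> nat" where
  "lag s t = (s - t) + (t - s)"

lemma lag_row_sum:
  fixes h :: "nat \<Rightarrow> real"
  assumes h: "\<And>k. h k \<ge> 0" and s: "s < n"
  shows "(\<Sum>t<n. h (lag s t)) \<le> h 0 + 2 * (\<Sum>k=1..n. h k)"
proof -
  have "(\<Sum>t<n. h (lag s t)) = (\<Sum>t<s. h (lag s t)) + (\<Sum>t=s..<n. h (lag s t))"
  proof -
    have "{..<n} = {..<s} \<union> {s..<n}" using s by auto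
    then show ?thesis by (simp add: sum.union_disjoint ivl_disj_int)
  qed
  also have "(\<Sum>t<s. h (lag s t)) = (\<Sum>k=1..s. h k)"
    by (rule sum.reindex_bij_witness[where i="\<lambda>k. s - k" and j="\<lambda>t. s - t"]) (auto simp: lag_def)
  also have "\<dots> \<le> (\<Sum>k=1..n. h k)" using s h by (intro sum_mono2) auto
  also have "(\<Sum>t=s..<n. h (lag s t)) = (\<Sum>k\<in>insert 0 {1..n - s - 1}. h k)"
    by (rule sum.reindex_bij_witness[where i="\<lambda>k. s + k" and j="\<lambda>t. t - s"]) (use s in \<open>auto simp: lag_def\<close>)
  also have "\<dots> = h 0 + (\<Sum>k=1..n - s - 1. h k)" by simp
  also have "(\<Sum>k=1..n - s - 1. h k) \<le> (\<Sum>k=1..n. h k)" using h by (intro sum_mono2) auto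
  finally show ?thesis by simp
qed

lemma sum_even_odd: "(\<Sum>s<2 * n. f s) = (\<Sum>s<n. f (2 * s)) + (\<Sum>s<n. f (2 * s + 1))"
  for f :: "nat \<Rightarrow> real"
  by (induction n) (simp_all add: algebra_simps)

text \<open>
  In probabilistic terms: a sum over \<open>2 n\<close> consecutive terms is \<open>A + B\<close>, the contributions of the even
  and of the odd indices, and the alternating sum is \<open>A - B\<close>.  From \<open>0 \<le> E (A - B)\<^sup>2\<close> one gets
  \<open>E (A + B)\<^sup>2 \<le> 2 * E A\<^sup>2 + 2 * E B\<^sup>2\<close>, and by stationarity both terms equal the sum over \<open>2 * lag s t\<close>.
\<close>

lemma lag_sum_doubling:
  fixes g :: "nat \<Rightarrow> real"
  assumes pd: "0 \<le> (\<Sum>s<2 * n. \<Sum>t<2 * n. (-1) ^ (s + t) * g (lag s t))"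
  shows "(\<Sum>s<2 * n. \<Sum>t<2 * n. g (lag s t)) \<le> 4 * (\<Sum>s<n. \<Sum>t<n. g (2 * lag s t))"
proof -
  have ee: "lag (2 * s) (2 * t) = 2 * lag s t" "lag (Suc (2 * s)) (Suc (2 * t)) = 2 * lag s t" for s t
    by (auto simp: lag_def)
  have pd': "(\<Sum>s<n. \<Sum>t<n. g (lag (2 * s) (Suc (2 * t)))) + (\<Sum>s<n. \<Sum>t<n. g (lag (Suc (2 * s)) (2 * t)))
     \<le> 2 * (\<Sum>s<n. \<Sum>t<n. g (2 * lag s t))"
    using pd by (simp add: sum_even_odd sum.distrib ee sum_negf sum_subtractf)
  then show ?thesis by (simp add: sum_even_odd sum.distrib ee)
qed

text \<open>
  With \<open>V n\<close> the double sum, doubling and the contraction of \<open>g\<close> at even lags give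
  \<open>V (2 n) \<le> 4 p * V n + E * n\<close> with \<open>p < 1\<close>, hence growth of order \<open>(4 p) ^ j\<close> at \<open>n = 2 ^ j\<close>, an exponent
  below two.  Only the values of \<open>g\<close> at \<open>k\<close> and \<open>2 k\<close> are compared, and this is exactly what the pointwise
  definition of slow variation controls.
\<close>

lemma lag_sum_power_bound:
  fixes g :: "nat \<Rightarrow> real"
  assumes g: "\<And>k. g k \<ge> 0"
    and pd: "\<And>n. 0 \<le> (\<Sum>s<n. \<Sum>t<n. (-1) ^ (s + t) * g (lag s t))"
    and q: "q < 1" "\<And>k. k \<ge> k0 \<Longrightarrow> g (2 * k) \<le> q * g k"
  obtains C \<delta> where "C \<ge> 0" "\<delta> > 0" "\<And>n. n \<ge> 1 \<Longrightarrow> (\<Sum>s<n. \<Sum>t<n. g (lag s t)) \<le> C * real n powr (2 - \<delta>)"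
proof -
  \<comment> \<open>the lower bound 3/4 makes \<open>4 * p > 2\<close>, so that the recursion dominates its linear error term\<close>
  define p where "p = max q (3/4)"
  have p: "3/4 \<le> p" "p < 1" "q \<le> p" using q by (auto simp: p_def)
  define V where "V n = (\<Sum>s<n. \<Sum>t<n. g (lag s t))" for n
  have V_mono: "V m \<le> V n" if "m \<le> n" for m n
  proof -
    have "V m \<le> (\<Sum>s<m. \<Sum>t<n. g (lag s t))" unfolding V_def
      using that g by (intro sum_mono sum_mono2) auto
    also have "\<dots> \<le> V n" unfolding V_def
      using that g by (intro sum_mono2 sum_nonneg) auto
    finally show ?thesis .
  qed
  define D where "D = (\<Sum>k<k0. g (2 * k))"
  have D: "D \<ge> 0" unfolding D_def by (intro sum_nonneg g)
  define E where "E = 4 * (g 0 + 2 * D + g 0)"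
  have E: "E \<ge> 0" using D g[of 0] by (simp add: E_def)
  have dbl: "V (2 * n) \<le> 4 * p * V n + E * real n" for n
  proof -
    define h where "h k = (if k < k0 then g (2 * k) else 0)" for k
    have h: "h k \<ge> 0" for k using g by (simp add: h_def)
    have le: "g (2 * k) \<le> p * g k + h k" for k
    proof (cases "k < k0")
      case True then show ?thesis using g[of k] p by (simp add: h_def)
    next
      case False
      then have "g (2 * k) \<le> q * g k" by (intro q) auto
      also have "\<dots> \<le> p * g k" using p g by (intro mult_right_mono) auto
      finally show ?thesis using h[of k] by simp
    qed
    have hsum: "(\<Sum>k=1..n. h k) \<le> D"
    proof -
      have "(\<Sum>k=1..n. h k) = (\<Sum>k\<in>{1..n} \<inter> {..<k0}. g (2 * k))"
        unfolding h_def by (subst sum.inter_restrict) (auto intro: sum.cong)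
      also have "\<dots> \<le> D" unfolding D_def using g by (intro sum_mono2) auto
      finally show ?thesis .
    qed
    have "V (2 * n) \<le> 4 * (\<Sum>s<n. \<Sum>t<n. g (2 * lag s t))"
      unfolding V_def by (rule lag_sum_doubling[OF pd])
    also have "(\<Sum>s<n. \<Sum>t<n. g (2 * lag s t)) \<le> (\<Sum>s<n. \<Sum>t<n. p * g (lag s t) + h (lag s t))"
      by (intro sum_mono le)
    also have "\<dots> = p * V n + (\<Sum>s<n. \<Sum>t<n. h (lag s t))"
      by (simp add: V_def sum.distrib sum_distrib_left)
    also have "(\<Sum>s<n. \<Sum>t<n. h (lag s t)) \<le> (\<Sum>s<n. g 0 + 2 * D + g 0)"
    proof (rule sum_mono)
      fix s assume "s \<in> {..<n}"
      then have "(\<Sum>t<n. h (lag s t)) \<le> h 0 + 2 * (\<Sum>k=1..n. h k)" by (intro lag_row_sum h) auto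
      also have "h 0 \<le> g 0 + g 0" using g[of 0] by (simp add: h_def)
      finally show "(\<Sum>t<n. h (lag s t)) \<le> g 0 + 2 * D + g 0" using hsum by simp
    qed
    finally show ?thesis by (simp add: E_def algebra_simps)
  qed
  have pow: "V (2 ^ j) + E * 2 ^ j \<le> (V 1 + E) * (4 * p) ^ j" for j
  proof (induction j)
    case (Suc j)
    have "V (2 ^ Suc j) + E * 2 ^ Suc j \<le> 4 * p * V (2 ^ j) + 3 * (E * 2 ^ j)"
      using dbl[of "2 ^ j"] by simp
    also have "\<dots> \<le> 4 * p * V (2 ^ j) + 4 * p * (E * 2 ^ j)"
      using p E by (intro add_left_mono mult_right_mono) auto
    also have "\<dots> \<le> (4 * p) * ((V 1 + E) * (4 * p) ^ j)"
      using Suc p by (simp flip: distrib_left)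
    finally show ?case by (simp add: algebra_simps)
  qed simp
  define \<delta> where "\<delta> = 2 - log 2 (4 * p)"
  have "log 2 (4 * p) < 2" using p by (subst log_less_iff) auto
  then have \<delta>: "\<delta> > 0" by (simp add: \<delta>_def)
  have "log 2 (4 * p) \<ge> 0" using p by simp
  have V1: "V 1 + E \<ge> 0" using E g[of 0] by (simp add: V_def lag_def)
  have "V n \<le> (V 1 + E) * 2 powr (2 - \<delta>) * real n powr (2 - \<delta>)" if n: "n \<ge> 1" for n
  proof -
    obtain i where i: "2 ^ i \<le> n" "n < 2 ^ (i + 1)" using ex_power_ivl1[of 2 n] n by auto
    define j where "j = i + 1"
    have j: "n \<le> 2 ^ j" "2 ^ j \<le> 2 * n" using i by (auto simp: j_def)
    have "V n \<le> V (2 ^ j) + E * 2 ^ j" using V_mono[OF j(1)] E by (simp add: add_increasing2)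
    also have "\<dots> \<le> (V 1 + E) * (4 * p) ^ j" by (rule pow)
    also have "(4 * p) ^ j = (2 powr (2 - \<delta>)) powr real j"
      using p by (simp add: \<delta>_def powr_realpow)
    also have "\<dots> = (2 ^ j) powr (2 - \<delta>)"
      by (simp add: powr_powr powr_realpow[symmetric] mult.commute)
    also have "\<dots> \<le> (real (2 * n)) powr (2 - \<delta>)"
      using of_nat_mono[OF j(2), where 'a=real] \<open>log 2 (4 * p) \<ge> 0\<close>
      by (intro powr_mono2) (auto simp: \<delta>_def)
    also have "\<dots> = 2 powr (2 - \<delta>) * real n powr (2 - \<delta>)" by (simp add: powr_mult)
    finally show ?thesis using V1 by (simp add: mult_left_mono mult.assoc)
  qed
  then show ?thesis using V1 \<delta> by (intro that[of "(V 1 + E) * 2 powr (2 - \<delta>)" \<delta>]) (auto simp: V_def)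
qed

text \<open>
  The comparison with the integral of \<open>x powr (- \<theta>)\<close>, in discrete form: the induction step is the
  weighted inequality between geometric and arithmetic mean of \<open>n\<close> and \<open>n + 1\<close>.
\<close>

lemma sum_powr_bound:
  assumes \<theta>: "0 < \<theta>" "\<theta> < 1"
  shows "(\<Sum>k=1..n. real k powr (- \<theta>)) \<le> real n powr (1 - \<theta>) / (1 - \<theta>)"
proof (induction n)
  case (Suc n)
  have step: "real n powr (1 - \<theta>) \<le> real (Suc n) powr (1 - \<theta>) - (1 - \<theta>) * real (Suc n) powr (- \<theta>)"
  proof (cases "n = 0")
    case False
    have "real n powr (1 - \<theta>) * real (Suc n) powr \<theta> \<le> (1 - \<theta>) * real n + \<theta> * real (Suc n)"
      using \<theta> False by (intro Youngs_inequality_0) auto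
    also have "\<dots> = real n + \<theta>" by (simp add: algebra_simps)
    finally have "real n powr (1 - \<theta>) * (real (Suc n) powr \<theta> * real (Suc n) powr (- \<theta>)) \<le> (real n + \<theta>) * real (Suc n) powr (- \<theta>)"
      unfolding mult.assoc[symmetric] by (rule mult_right_mono) simp
    also have "real (Suc n) powr \<theta> * real (Suc n) powr (- \<theta>) = 1" by (simp flip: powr_add)
    also have "(real n + \<theta>) * real (Suc n) powr (- \<theta>) = real (Suc n) * real (Suc n) powr (- \<theta>) - (1 - \<theta>) * real (Suc n) powr (- \<theta>)"
      by (simp add: algebra_simps)
    also have "real (Suc n) * real (Suc n) powr (- \<theta>) = real (Suc n) powr (1 - \<theta>)"
      using powr_add[of "real (Suc n)" 1 "- \<theta>"] by simp
    finally show ?thesis by simp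
  qed (use \<theta> in simp)
  have "(\<Sum>k=1..Suc n. real k powr (- \<theta>)) \<le> real n powr (1 - \<theta>) / (1 - \<theta>) + real (Suc n) powr (- \<theta>)"
    using Suc by simp
  also have "\<dots> = (real n powr (1 - \<theta>) + (1 - \<theta>) * real (Suc n) powr (- \<theta>)) / (1 - \<theta>)"
    using \<theta> by (simp add: add_divide_distrib)
  also have "\<dots> \<le> real (Suc n) powr (1 - \<theta>) / (1 - \<theta>)"
    using step \<theta> by (intro divide_right_mono) auto
  finally show ?case .
qed simp

lemma lag_sum_powr_bound:
  assumes \<theta>: "0 < \<theta>" "\<theta> < 1" and n: "n \<ge> 1"
  shows "(\<Sum>s<n. \<Sum>t<n. (if lag s t = 0 then 1 else real (lag s t) powr (- \<theta>)))
    \<le> (1 + 2 / (1 - \<theta>)) * real n powr (2 - \<theta>)"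
proof -
  define h where "h k = (if k = 0 then 1 else real k powr (- \<theta>))" for k
  have "(\<Sum>s<n. \<Sum>t<n. h (lag s t)) \<le> (\<Sum>s<n. h 0 + 2 * (\<Sum>k=1..n. h k))"
    by (intro sum_mono lag_row_sum) (auto simp: h_def)
  also have "(\<Sum>k=1..n. h k) = (\<Sum>k=1..n. real k powr (- \<theta>))" by (rule sum.cong) (auto simp: h_def)
  also have "(\<Sum>s<n. h 0 + 2 * (\<Sum>k=1..n. real k powr (- \<theta>))) \<le> (\<Sum>s<n. real n powr (1 - \<theta>) + 2 * (real n powr (1 - \<theta>) / (1 - \<theta>)))"
    using sum_powr_bound[OF \<theta>, of n] ge_one_powr_ge_zero[of "real n" "1 - \<theta>"] \<theta> n
    by (intro sum_mono add_mono) (auto simp: h_def)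
  also have "\<dots> = (1 + 2 / (1 - \<theta>)) * (real n * real n powr (1 - \<theta>))"
    by (simp add: algebra_simps)
  also have "real n * real n powr (1 - \<theta>) = real n powr (2 - \<theta>)"
    using n powr_add[of "real n" 1 "1 - \<theta>"] by simp
  finally show ?thesis by (simp add: h_def)
qed

section \<open>Stationarity, independence and Gaussian sums\<close>

lemma measurable_trajectory:
  assumes "\<And>t. t \<ge> 1 \<Longrightarrow> Z t \<in> borel_measurable M"
  shows "trajectory Z \<in> measurable M path_space"
  unfolding trajectory_def by (intro measurable_restrict assms) auto

text \<open>
  Stationarity is equality of laws on path space, and the product is a measurable function of the
  path.
\<close>

lemma stationary_product:
  fixes Z :: "nat \<Rightarrow> 'a \<Rightarrow> 'b::topological_space" and f :: "'b \<Rightarrow> real"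
  assumes st: "stationary M Z" and meas: "\<And>t. t \<ge> 1 \<Longrightarrow> Z t \<in> borel_measurable M"
    and f[measurable]: "f \<in> borel_measurable borel"
  shows "(\<integral>\<omega>. f (Z (1 + h) \<omega>) * f (Z (k + 1 + h) \<omega>) \<partial>M) = (\<integral>\<omega>. f (Z 1 \<omega>) * f (Z (k + 1) \<omega>) \<partial>M)"
proof -
  define F where "F x = f (x 1) * f (x (k + 1))" for x :: "nat \<Rightarrow> 'b"
  have F: "F \<in> borel_measurable path_space"
    unfolding F_def
    by (intro borel_measurable_times measurable_compose[OF _ f] measurable_component_singleton) auto
  have m: "trajectory (\<lambda>t. Z (t + h)) \<in> measurable M path_space" "trajectory Z \<in> measurable M path_space"
    by (intro measurable_trajectory meas; simp)+
  have "(\<integral>x. F x \<partial>distr M path_space (trajectory (\<lambda>t. Z (t + h)))) = (\<integral>x. F x \<partial>distr M path_space (trajectory Z))"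
    using st by (simp add: stationary_def)
  then show ?thesis
    unfolding integral_distr[OF m(1) F] integral_distr[OF m(2) F] by (simp add: F_def trajectory_def)
qed

text \<open>
  Measurable functionals of the two paths generate sub-sigma-algebras of the independent ones.  This
  brings independence of sequences of different types into the form of the library's \<open>indep_var\<close>.
\<close>

lemma (in prob_space) independent_sequences_indep_var:
  fixes U :: "nat \<Rightarrow> 'a \<Rightarrow> 'b::topological_space" and V :: "nat \<Rightarrow> 'a \<Rightarrow> 'c::topological_space"
  assumes ind: "independent_sequences M U V"
    and U: "\<And>t. t \<ge> 1 \<Longrightarrow> U t \<in> borel_measurable M" and V: "\<And>t. t \<ge> 1 \<Longrightarrow> V t \<in> borel_measurable M"
    and F: "F \<in> borel_measurable path_space" and G: "G \<in> borel_measurable path_space"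
  shows "indep_var borel (\<lambda>\<omega>. F (trajectory U \<omega>)) borel (\<lambda>\<omega>. G (trajectory V \<omega>))"
proof -
  have sub: "sigma_sets (space M) {(\<lambda>\<omega>. H (trajectory Z \<omega>)) -` A \<inter> space M |A. A \<in> sets borel}
      \<subseteq> sets (vimage_algebra (space M) (trajectory Z) path_space)"
    if H: "H \<in> borel_measurable path_space" and Z: "\<And>t. t \<ge> 1 \<Longrightarrow> Z t \<in> borel_measurable M"
    for H :: "(nat \<Rightarrow> 'e::topological_space) \<Rightarrow> 'f::topological_space" and Z :: "nat \<Rightarrow> 'a \<Rightarrow> 'e"
  proof -
    let ?N = "vimage_algebra (space M) (trajectory Z) path_space"
    have "(\<lambda>\<omega>. H (trajectory Z \<omega>)) \<in> borel_measurable ?N"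
      by (rule measurable_compose[OF measurable_vimage_algebra1 H])
        (use measurable_space[OF measurable_trajectory[OF Z]] in auto)
    then have "{(\<lambda>\<omega>. H (trajectory Z \<omega>)) -` A \<inter> space M |A. A \<in> sets borel} \<subseteq> sets ?N"
      by (auto dest: measurable_sets)
    from sets.sigma_sets_subset[OF this] show ?thesis by simp
  qed
  have "indep_sets (case_bool (sets (vimage_algebra (space M) (trajectory U) path_space))
      (sets (vimage_algebra (space M) (trajectory V) path_space))) UNIV"
    using ind unfolding independent_sequences_def indep_set_def .
  then have "indep_set (sigma_sets (space M) {(\<lambda>\<omega>. F (trajectory U \<omega>)) -` A \<inter> space M |A. A \<in> sets borel})
      (sigma_sets (space M) {(\<lambda>\<omega>. G (trajectory V \<omega>)) -` A \<inter> space M |A. A \<in> sets borel})"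
    unfolding indep_set_def
    by (rule indep_sets_mono_sets) (use sub[OF F U] sub[OF G V] in \<open>auto split: bool.split\<close>)
  then show ?thesis
    unfolding indep_var_eq
    using measurable_compose[OF measurable_trajectory[OF U] F] measurable_compose[OF measurable_trajectory[OF V] G]
    by simp
qed

lemma distributed_AE_cong:
  assumes "distributed M N X f" "AE \<omega> in M. X \<omega> = Y \<omega>" "Y \<in> measurable M N"
  shows "distributed M N Y f"
proof -
  have "distr M N Y = distr M N X" using assms by (intro distr_cong_AE) (auto simp: distributed_def)
  then show ?thesis using assms by (simp add: distributed_def)
qed

lemma gaussian_rv_normal:
  "s > 0 \<Longrightarrow> distributed M lborel V (normal_density \<mu> s) \<Longrightarrow> gaussian_rv M V"
  unfolding gaussian_rv_def by (auto simp: distributed_def)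

lemma gaussian_rv_AE_const:
  "V \<in> borel_measurable M \<Longrightarrow> AE \<omega> in M. V \<omega> = \<mu> \<Longrightarrow> gaussian_rv M V"
  unfolding gaussian_rv_def by (intro conjI exI disjI2)

lemma (in prob_space) gaussian_rv_translate:
  assumes "gaussian_rv M V"
  shows "gaussian_rv M (\<lambda>\<omega>. m + V \<omega>)"
proof -
  have [measurable]: "V \<in> borel_measurable M" using assms by (simp add: gaussian_rv_def)
  obtain \<mu> s where "s > 0 \<and> distributed M lborel V (normal_density \<mu> s) \<or> (AE \<omega> in M. V \<omega> = \<mu>)"
    using assms by (auto simp: gaussian_rv_def)
  then show ?thesis
  proof
    assume *: "s > 0 \<and> distributed M lborel V (normal_density \<mu> s)"
    then have "distributed M lborel (\<lambda>\<omega>. m + 1 * V \<omega>) (normal_density (m + 1 * \<mu>) (\<bar>1\<bar> * s))"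
      by (intro normal_density_affine) auto
    then have "distributed M lborel (\<lambda>\<omega>. m + V \<omega>) (normal_density (m + \<mu>) s)" by simp
    then show ?thesis using * by (intro gaussian_rv_normal) auto
  next
    assume "AE \<omega> in M. V \<omega> = \<mu>"
    then have "AE \<omega> in M. m + V \<omega> = m + \<mu>" by eventually_elim simp
    then show ?thesis by (intro gaussian_rv_AE_const) auto
  qed
qed

lemma gaussian_rv_AE_cong:
  assumes "gaussian_rv M V" "AE \<omega> in M. V \<omega> = U \<omega>" and [measurable]: "U \<in> borel_measurable M"
  shows "gaussian_rv M U"
proof -
  obtain \<mu> s where "s > 0 \<and> distributed M lborel V (normal_density \<mu> s) \<or> (AE \<omega> in M. V \<omega> = \<mu>)"
    using assms by (auto simp: gaussian_rv_def)
  then show ?thesis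
  proof
    assume *: "s > 0 \<and> distributed M lborel V (normal_density \<mu> s)"
    then have "distributed M lborel U (normal_density \<mu> s)"
      by (intro distributed_AE_cong[OF conjunct2[OF *] assms(2)]) simp
    then show ?thesis using conjunct1[OF *] by (intro gaussian_rv_normal)
  next
    assume "AE \<omega> in M. V \<omega> = \<mu>"
    with assms(2) have "AE \<omega> in M. U \<omega> = \<mu>" by eventually_elim (rule trans[OF sym])
    then show ?thesis by (intro gaussian_rv_AE_const) auto
  qed
qed

lemma (in prob_space) gaussian_rv_add:
  assumes ind: "indep_var borel U borel V" and U: "gaussian_rv M U" and V: "gaussian_rv M V"
  shows "gaussian_rv M (\<lambda>\<omega>. U \<omega> + V \<omega>)"
proof -
  have [measurable]: "U \<in> borel_measurable M" "V \<in> borel_measurable M" using U V by (auto simp: gaussian_rv_def)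
  consider (deg1) \<mu> where "AE \<omega> in M. U \<omega> = \<mu>" | (deg2) \<mu> where "AE \<omega> in M. V \<omega> = \<mu>"
    | (pos) \<mu> s \<nu> t where "s > 0" "t > 0" "distributed M lborel U (normal_density \<mu> s)" "distributed M lborel V (normal_density \<nu> t)"
    using U V unfolding gaussian_rv_def by blast
  then show ?thesis
  proof cases
    case deg1
    then have "AE \<omega> in M. \<mu> + V \<omega> = U \<omega> + V \<omega>" by eventually_elim simp
    then show ?thesis by (intro gaussian_rv_AE_cong[OF gaussian_rv_translate[OF V, of \<mu>]]) auto
  next
    case deg2
    then have "AE \<omega> in M. \<mu> + U \<omega> = U \<omega> + V \<omega>" by eventually_elim simp
    then show ?thesis by (intro gaussian_rv_AE_cong[OF gaussian_rv_translate[OF U, of \<mu>]]) auto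
  next
    case pos
    from add_indep_normal[OF ind pos] show ?thesis
      using pos by (intro gaussian_rv_normal[of "sqrt (s\<^sup>2 + t\<^sup>2)"]) (auto simp: add_pos_pos)
  qed
qed

lemma (in prob_space) gaussian_rv_integrable:
  assumes V: "gaussian_rv M V" shows "integrable M V"
proof -
  have [measurable]: "V \<in> borel_measurable M" using V by (auto simp: gaussian_rv_def)
  obtain \<mu> s where "s > 0 \<and> distributed M lborel V (normal_density \<mu> s) \<or> (AE \<omega> in M. V \<omega> = \<mu>)"
    using V by (auto simp: gaussian_rv_def)
  then show ?thesis
  proof
    assume *: "s > 0 \<and> distributed M lborel V (normal_density \<mu> s)"
    then have "distributed M lborel (\<lambda>\<omega>. - \<mu> + 1 * V \<omega>) (normal_density (- \<mu> + 1 * \<mu>) (\<bar>1\<bar> * s))"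
      by (intro normal_density_affine) auto
    then have d: "distributed M lborel (\<lambda>\<omega>. - \<mu> + V \<omega>) (normal_density 0 s)" by simp
    have "centred_gaussian M (expectation (\<lambda>\<omega>. (- \<mu> + V \<omega>)\<^sup>2)) (\<lambda>\<omega>. - \<mu> + V \<omega>)"
      unfolding centred_gaussian_def
      by (intro conjI refl gaussian_rv_translate[OF V]
          normal_distributed_expectation[OF conjunct1[OF *] d])
    from Bochner_Integration.integrable_add[OF centred_gaussian_moments(1)[OF this] integrable_const[of \<mu>]]
    show ?thesis by simp
  next
    assume "AE \<omega> in M. V \<omega> = \<mu>"
    then show ?thesis by (subst integrable_cong_AE[of _ _ "\<lambda>_. \<mu>"]) auto
  qed
qed

lemma gaussian_sequence_pair:
  assumes "gaussian_sequence M Z" "s \<ge> 1" "t \<ge> 1"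
  shows "gaussian_rv M (\<lambda>\<omega>. a \<bullet> Z s \<omega> + b \<bullet> Z t \<omega>)"
proof -
  have comb: "gaussian_rv M (\<lambda>\<omega>. \<Sum>k\<in>J. c k \<bullet> Z k \<omega>)" if "finite J" "J \<subseteq> {1..}" for J c
    using assms(1) that unfolding gaussian_sequence_def by blast
  show ?thesis
  proof (cases "s = t")
    case True
    with comb[of "{s}" "\<lambda>_. a + b"] assms show ?thesis by (simp add: inner_add_left)
  next
    case False
    with comb[of "{s, t}" "\<lambda>k. if k = s then a else b"] assms show ?thesis by simp
  qed
qed

lemma (in prob_space) gaussian_sequence_projection:
  fixes X :: "nat \<Rightarrow> 'a \<Rightarrow> 'b::euclidean_space"
  assumes X: "gaussian_sequence M X" "t \<ge> 1" and mean: "expectation (X t) = 0"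
  shows "centred_gaussian M (expectation (\<lambda>\<omega>. (X t \<omega> \<bullet> u)\<^sup>2)) (\<lambda>\<omega>. X t \<omega> \<bullet> u)"
proof -
  have g: "gaussian_rv M (\<lambda>\<omega>. X t \<omega> \<bullet> w)" for w
    using gaussian_sequence_pair[OF X(1,2,2), of w 0] by (simp add: inner_commute)
  have "integrable M (\<lambda>\<omega>. \<Sum>i\<in>Basis. (X t \<omega> \<bullet> i) *\<^sub>R i)"
    by (intro Bochner_Integration.integrable_sum integrable_scaleR_left gaussian_rv_integrable g)
  then have "integrable M (X t)" by (simp add: euclidean_representation)
  then have "expectation (\<lambda>\<omega>. X t \<omega> \<bullet> u) = 0" using mean by (simp add: integral_inner_left)
  then show ?thesis using g by (simp add: centred_gaussian_def)
qed

section \<open>Residual processes of the regression model\<close>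

lemma stationary_autocovariance:
  fixes Z :: "nat \<Rightarrow> 'a \<Rightarrow> 'b::topological_space" and f :: "'b \<Rightarrow> real"
  assumes st: "stationary M Z" and meas: "\<And>t. t \<ge> 1 \<Longrightarrow> Z t \<in> borel_measurable M"
    and f: "f \<in> borel_measurable borel" and "s \<ge> 1" "t \<ge> 1"
  shows "(\<integral>\<omega>. f (Z s \<omega>) * f (Z t \<omega>) \<partial>M) = (\<integral>\<omega>. f (Z 1 \<omega>) * f (Z (lag s t + 1) \<omega>) \<partial>M)"
proof (cases "s \<le> t")
  case True
  then show ?thesis
    using stationary_product[OF st meas f, of "s - 1" "t - s"] assms(4,5) by (simp add: lag_def)
next
  case False
  then show ?thesis
    using stationary_product[OF st meas f, of "t - 1" "s - t"] assms(4,5) by (simp add: lag_def mult.commute)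
qed

text \<open>
  The factor \<open>2 powr (- \<alpha>) < 1\<close> gained by doubling the argument absorbs the ratio
  \<open>L (2 * k) / L k\<close>, which tends to one.
\<close>

lemma slowly_varying_doubling:
  assumes "slowly_varying L" "0 < \<alpha>"
  obtains q k0 where "q < 1"
    "\<And>k::nat. k \<ge> k0 \<Longrightarrow> real (2 * k) powr (- \<alpha>) * L (real (2 * k)) \<le> q * (real k powr (- \<alpha>) * L (real k))"
proof -
  define q where "q = (1 + 2 powr (- \<alpha>)) / 2"
  have "2 powr (- \<alpha>) < 2 powr (0::real)" using assms(2) by (intro powr_less_mono) auto
  then have q: "2 powr (- \<alpha>) < q" "q < 1" by (auto simp: q_def)
  have "((\<lambda>x. L (2 * x) / L x) \<longlongrightarrow> 1) at_top" using assms(1) by (simp add: slowly_varying_def)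
  then have lim: "(\<lambda>k. L (2 * real k) / L (real k)) \<longlonglongrightarrow> 1"
    by (rule filterlim_compose[OF _ filterlim_real_sequentially])
  have "1 < q * 2 powr \<alpha>" using q(1) by (simp add: powr_minus field_simps)
  from order_tendstoD(2)[OF lim this]
  have "\<forall>\<^sub>F k in sequentially. k \<ge> 1 \<and> L (2 * real k) / L (real k) < q * 2 powr \<alpha>"
    using eventually_ge_at_top[of 1] by eventually_elim simp
  then obtain k0 where k0: "\<And>k. k \<ge> k0 \<Longrightarrow> k \<ge> 1 \<and> L (2 * real k) / L (real k) < q * 2 powr \<alpha>"
    by (auto simp: eventually_sequentially)
  show ?thesis
  proof (rule that[of q k0])
    fix k :: nat assume "k \<ge> k0"
    note k = k0[OF this]
    have "L (real k) > 0" using assms(1) k by (simp add: slowly_varying_def)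
    then have L: "L (2 * real k) \<le> q * 2 powr \<alpha> * L (real k)" using k by (simp add: field_simps)
    have "real (2 * k) powr (- \<alpha>) * L (real (2 * k)) = 2 powr (- \<alpha>) * real k powr (- \<alpha>) * L (2 * real k)"
      by (simp add: powr_mult)
    also have "\<dots> \<le> 2 powr (- \<alpha>) * real k powr (- \<alpha>) * (q * 2 powr \<alpha> * L (real k))"
      using L by (intro mult_left_mono) auto
    also have "\<dots> = (2 powr (- \<alpha>) * 2 powr \<alpha>) * (q * (real k powr (- \<alpha>) * L (real k)))"
      by (simp only: ac_simps)
    also have "2 powr (- \<alpha>) * 2 powr \<alpha> = 1" by (simp flip: powr_add)
    finally show "real (2 * k) powr (- \<alpha>) * L (real (2 * k)) \<le> q * (real k powr (- \<alpha>) * L (real k))" by simp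
  qed (use q in auto)
qed

lemma matrix_conjugation_form:
  fixes A N :: "real ^ 'd ^ 'd" and u :: "real ^ 'd"
  shows "u \<bullet> ((transpose A ** N ** A) *v u) = (A *v u) \<bullet> (N *v (A *v u))"
proof -
  have "u \<bullet> ((transpose A ** N ** A) *v u) = u \<bullet> (transpose A *v (N *v (A *v u)))"
    by (simp add: matrix_vector_mul_assoc matrix_mul_assoc)
  also have "\<dots> = (A *v u) \<bullet> (N *v (A *v u))"
    by (metis dot_lmul_matrix vector_transpose_matrix transpose_transpose)
  finally show ?thesis .
qed

lemma power_diag_form:
  "w \<bullet> (power_diag \<theta> k *v w) = (\<Sum>i\<in>UNIV. real k powr (- \<theta> i) * (w $ i)\<^sup>2)"
proof -
  have "(power_diag \<theta> k *v w) $ i = real k powr (- \<theta> i) * w $ i" for i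
  proof -
    have "(power_diag \<theta> k *v w) $ i = (\<Sum>j\<in>UNIV. if i = j then real k powr (- \<theta> i) * w $ j else 0)"
      unfolding matrix_vector_mult_def power_diag_def by (simp add: if_distrib[of "\<lambda>x. x * _"] cong: if_cong)
    then show ?thesis by simp
  qed
  then show ?thesis by (simp add: inner_vec_def power2_eq_square ac_simps)
qed

text \<open>
  An orthogonal change of coordinates preserves \<open>norm u\<close> and diagonalises the form, so its size is
  governed by the smallest memory exponent, uniformly in the matrix.
\<close>

lemma power_diag_form_bounds:
  fixes A :: "real ^ 'd ^ 'd" and u :: "real ^ 'd"
  assumes A: "orthogonal_matrix A" and \<theta>: "\<And>i. \<theta>0 \<le> \<theta> i" and k: "k \<ge> 1"
  shows "0 \<le> u \<bullet> ((transpose A ** power_diag \<theta> k ** A) *v u)"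
    and "u \<bullet> ((transpose A ** power_diag \<theta> k ** A) *v u) \<le> real k powr (- \<theta>0) * (norm u)\<^sup>2"
proof -
  note eq = matrix_conjugation_form[of u A "power_diag \<theta> k"] power_diag_form[of "A *v u" \<theta> k]
  show "0 \<le> u \<bullet> ((transpose A ** power_diag \<theta> k ** A) *v u)"
    unfolding eq by (intro sum_nonneg) auto
  have "(\<Sum>i\<in>UNIV. real k powr (- \<theta> i) * ((A *v u) $ i)\<^sup>2) \<le> (\<Sum>i\<in>UNIV. real k powr (- \<theta>0) * ((A *v u) $ i)\<^sup>2)"
    using \<theta> k by (intro sum_mono mult_right_mono powr_mono) auto
  also have "\<dots> = real k powr (- \<theta>0) * (norm (A *v u))\<^sup>2"
    unfolding sum_distrib_left[symmetric] power2_norm_eq_inner inner_vec_def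
    by (simp add: power2_eq_square)
  also have "norm (A *v u) = norm u"
    using A by (intro orthogonal_transformation_norm)
      (simp add: orthogonal_transformation_matrix)
  finally show "u \<bullet> ((transpose A ** power_diag \<theta> k ** A) *v u) \<le> real k powr (- \<theta>0) * (norm u)\<^sup>2"
    unfolding eq .
qed

locale gaussian_regression = prob_space M for M :: "'w measure" +
  fixes X :: "nat \<Rightarrow> 'w \<Rightarrow> real ^ 'd" and \<epsilon> :: "nat \<Rightarrow> 'w \<Rightarrow> real"
    and \<sigma>\<^sub>0 \<alpha> :: real and \<theta> :: "'d \<Rightarrow> real" and Lm :: "real \<Rightarrow> real ^ 'd ^ 'd" and L :: "real \<Rightarrow> real"
  assumes X_gauss: "gaussian_sequence M X" and X_stat: "stationary M X"
    and X_mean: "\<And>t. t \<ge> 1 \<Longrightarrow> expectation (X t) = 0"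
    and \<theta>: "\<And>i. 0 < \<theta> i \<and> \<theta> i < 1"
    and Lm: "slowly_varying_orthogonal Lm"
    and X_cov: "\<And>t. t \<ge> 1 \<Longrightarrow> autocov M X t = transpose (Lm (real t)) ** power_diag \<theta> t ** Lm (real t)"
    and eps_gauss: "gaussian_sequence M \<epsilon>" and eps_stat: "stationary M \<epsilon>"
    and eps_mean: "\<And>t. t \<ge> 1 \<Longrightarrow> expectation (\<epsilon> t) = 0"
    and eps_var: "\<And>t. t \<ge> 1 \<Longrightarrow> expectation (\<lambda>\<omega>. (\<epsilon> t \<omega>)\<^sup>2) = \<sigma>\<^sub>0\<^sup>2"
    and \<alpha>: "0 < \<alpha>"
    and L: "slowly_varying L"
    and eps_cov: "\<And>t. t \<ge> 1 \<Longrightarrow> expectation (\<lambda>\<omega>. \<epsilon> 1 \<omega> * \<epsilon> (t + 1) \<omega>) = real t powr (- \<alpha>) * L (real t)"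
    and indep: "independent_sequences M \<epsilon> X"
begin

lemma X_meas: "t \<ge> 1 \<Longrightarrow> X t \<in> borel_measurable M"
  and eps_meas: "t \<ge> 1 \<Longrightarrow> \<epsilon> t \<in> borel_measurable M"
  using X_gauss eps_gauss by (auto simp: gaussian_sequence_def)

definition noise_cov where "noise_cov k = expectation (\<lambda>\<omega>. \<epsilon> 1 \<omega> * \<epsilon> (k + 1) \<omega>)"

definition regressor_cov where "regressor_cov u k = expectation (\<lambda>\<omega>. (X 1 \<omega> \<bullet> u) * (X (k + 1) \<omega> \<bullet> u))"

lemma eps_centred: "t \<ge> 1 \<Longrightarrow> centred_gaussian M (\<sigma>\<^sub>0\<^sup>2) (\<epsilon> t)"
  using gaussian_sequence_projection[OF eps_gauss _ eps_mean, of t 1] eps_var[of t] by simp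

lemma X_centred:
  assumes "t \<ge> 1" shows "centred_gaussian M (regressor_cov u 0) (\<lambda>\<omega>. X t \<omega> \<bullet> u)"
proof -
  have "expectation (\<lambda>\<omega>. (X t \<omega> \<bullet> u)\<^sup>2) = regressor_cov u 0"
    using stationary_autocovariance[OF X_stat X_meas, where f="\<lambda>x. x \<bullet> u" and s=t and t=t] assms
    by (simp add: regressor_cov_def power2_eq_square lag_def)
  then show ?thesis using gaussian_sequence_projection[OF X_gauss _ X_mean, of t u] assms by simp
qed

lemma eps_product: assumes "s \<ge> 1" "t \<ge> 1"
  shows "integrable M (\<lambda>\<omega>. \<epsilon> s \<omega> * \<epsilon> t \<omega>)" "expectation (\<lambda>\<omega>. \<epsilon> s \<omega> * \<epsilon> t \<omega>) = noise_cov (lag s t)"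
proof -
  show "integrable M (\<lambda>\<omega>. \<epsilon> s \<omega> * \<epsilon> t \<omega>)"
    by (intro integrable_product eps_meas centred_gaussian_moments(2)[OF eps_centred] assms)
  show "expectation (\<lambda>\<omega>. \<epsilon> s \<omega> * \<epsilon> t \<omega>) = noise_cov (lag s t)"
    using stationary_autocovariance[OF eps_stat eps_meas, where f="\<lambda>x. x" and s=s and t=t] assms
    by (simp add: noise_cov_def)
qed

lemma X_proj_meas: "t \<ge> 1 \<Longrightarrow> (\<lambda>\<omega>. X t \<omega> \<bullet> u) \<in> borel_measurable M"
  using X_centred centred_gaussian_measurable by blast

lemma X_product: assumes "s \<ge> 1" "t \<ge> 1"
  shows "integrable M (\<lambda>\<omega>. (X s \<omega> \<bullet> u) * (X t \<omega> \<bullet> w))"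
    "expectation (\<lambda>\<omega>. (X s \<omega> \<bullet> u) * (X t \<omega> \<bullet> u)) = regressor_cov u (lag s t)"
proof -
  show "integrable M (\<lambda>\<omega>. (X s \<omega> \<bullet> u) * (X t \<omega> \<bullet> w))"
    by (intro integrable_product X_proj_meas centred_gaussian_moments(2)[OF X_centred] assms)
  show "expectation (\<lambda>\<omega>. (X s \<omega> \<bullet> u) * (X t \<omega> \<bullet> u)) = regressor_cov u (lag s t)"
    using stationary_autocovariance[OF X_stat X_meas, where f="\<lambda>x. x \<bullet> u" and s=s and t=t] assms
    by (simp add: regressor_cov_def)
qed

lemma noise_cov_nonneg: "noise_cov k \<ge> 0"
proof (cases "k = 0")
  case True
  then show ?thesis by (auto simp: noise_cov_def intro: Bochner_Integration.integral_nonneg)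
next
  case False
  then have "L (real k) > 0" using L by (simp add: slowly_varying_def)
  then show ?thesis using eps_cov[of k] False by (simp add: noise_cov_def)
qed

text \<open>
  The alternating double sum required by \<open>lag_sum_power_bound\<close> is the second moment of the alternating
  partial sum of the noise.
\<close>

lemma noise_sum_bound:
  obtains C \<delta> where "C \<ge> 0" "\<delta> > 0" "\<And>n. n \<ge> 1 \<Longrightarrow> (\<Sum>s<n. \<Sum>t<n. noise_cov (lag s t)) \<le> C * real n powr (2 - \<delta>)"
proof -
  obtain q k0 where q: "q < 1"
    "\<And>k::nat. k \<ge> k0 \<Longrightarrow> real (2 * k) powr (- \<alpha>) * L (real (2 * k)) \<le> q * (real k powr (- \<alpha>) * L (real k))"
    using slowly_varying_doubling[OF L \<alpha>] by blast
  show ?thesis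
  proof (rule lag_sum_power_bound[of noise_cov q "k0 + 1", OF noise_cov_nonneg _ q(1)])
    fix k assume "k \<ge> k0 + 1"
    then show "noise_cov (2 * k) \<le> q * noise_cov k" using q(2)[of k] eps_cov[of k] eps_cov[of "2 * k"] by (simp add: noise_cov_def)
  next
    fix n
    have "0 \<le> expectation (\<lambda>\<omega>. (\<Sum>s<n. (-1) ^ s * \<epsilon> (Suc s) \<omega>)\<^sup>2)"
      by (intro Bochner_Integration.integral_nonneg) auto
    also have "\<dots> = expectation (\<lambda>\<omega>. \<Sum>s<n. \<Sum>t<n. (-1) ^ (s + t) * (\<epsilon> (Suc s) \<omega> * \<epsilon> (Suc t) \<omega>))"
      by (simp add: power2_eq_square sum_product power_add ac_simps)
    also have "\<dots> = (\<Sum>s<n. \<Sum>t<n. (-1) ^ (s + t) * expectation (\<lambda>\<omega>. \<epsilon> (Suc s) \<omega> * \<epsilon> (Suc t) \<omega>))"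
      by (simp add: eps_product(1))
    also have "\<dots> = (\<Sum>s<n. \<Sum>t<n. (-1) ^ (s + t) * noise_cov (lag s t))"
      by (simp add: eps_product(2)) (simp add: lag_def)
    finally show "0 \<le> (\<Sum>s<n. \<Sum>t<n. (-1) ^ (s + t) * noise_cov (lag s t))" .
  qed (use that in blast)
qed

lemma regressor_decay:
  assumes k: "k \<ge> 1" and \<theta>0: "\<And>i. \<theta>0 \<le> \<theta> i"
  shows "\<bar>regressor_cov u k\<bar> \<le> real k powr (- \<theta>0) * (norm u)\<^sup>2"
proof -
  have int: "integrable M (\<lambda>\<omega>. X 1 \<omega> $ i * X (k + 1) \<omega> $ j)" for i j
    using X_product(1)[of 1 "k + 1" "axis i 1" "axis j 1"] by (simp add: inner_axis)
  have "regressor_cov u k = expectation (\<lambda>\<omega>. \<Sum>i\<in>UNIV. \<Sum>j\<in>UNIV. u $ i * u $ j * (X 1 \<omega> $ i * X (k + 1) \<omega> $ j))"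
    unfolding regressor_cov_def inner_vec_def by (simp add: sum_product ac_simps)
  also have "\<dots> = (\<Sum>i\<in>UNIV. \<Sum>j\<in>UNIV. u $ i * u $ j * expectation (\<lambda>\<omega>. X 1 \<omega> $ i * X (k + 1) \<omega> $ j))"
    using int by simp
  also have "\<dots> = u \<bullet> (autocov M X k *v u)"
    by (simp add: inner_vec_def matrix_vector_mult_def autocov_def sum_distrib_left ac_simps)
  also have "\<dots> = u \<bullet> ((transpose (Lm (real k)) ** power_diag \<theta> k ** Lm (real k)) *v u)"
    using X_cov[OF k] by simp
  finally have eq: "regressor_cov u k = \<dots>" .
  have "orthogonal_matrix (Lm (real k))" using Lm k by (simp add: slowly_varying_orthogonal_def)
  from power_diag_form_bounds[OF this \<theta>0 k, of u] show ?thesis unfolding eq by simp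
qed

lemma cross_indep:
  assumes "s \<ge> 1" "t \<ge> 1"
  shows "indep_var borel (\<lambda>\<omega>. a * \<epsilon> s \<omega> + b * \<epsilon> t \<omega>) borel (\<lambda>\<omega>. c * (X s \<omega> \<bullet> u) + d * (X t \<omega> \<bullet> u))"
proof -
  have comp: "(\<lambda>x. x k) \<in> measurable path_space borel" if "k \<ge> 1" for k
    using that by (intro measurable_component_singleton) auto
  have F: "(\<lambda>x. a * x s + b * x t) \<in> borel_measurable (path_space :: (nat \<Rightarrow> real) measure)"
    by (intro borel_measurable_add borel_measurable_times borel_measurable_const comp assms)
  have G: "(\<lambda>x. c * (x s \<bullet> u) + d * (x t \<bullet> u)) \<in> borel_measurable (path_space :: (nat \<Rightarrow> real ^ 'd) measure)"
    by (intro borel_measurable_add borel_measurable_times borel_measurable_const borel_measurable_inner comp assms)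
  show ?thesis
    using independent_sequences_indep_var[OF indep eps_meas X_meas F G] assms
    by (simp add: trajectory_def)
qed

lemma cross_product:
  assumes "s \<ge> 1" "t \<ge> 1"
  shows "integrable M (\<lambda>\<omega>. \<epsilon> s \<omega> * (X t \<omega> \<bullet> u))" "expectation (\<lambda>\<omega>. \<epsilon> s \<omega> * (X t \<omega> \<bullet> u)) = 0"
proof -
  have ind: "indep_var borel (\<epsilon> s) borel (\<lambda>\<omega>. X t \<omega> \<bullet> u)"
    using cross_indep[OF assms, of 1 0 0 u 1] by simp
  note i = centred_gaussian_moments(1)[OF eps_centred[OF assms(1)]] centred_gaussian_moments(1)[OF X_centred[OF assms(2)]]
  show "integrable M (\<lambda>\<omega>. \<epsilon> s \<omega> * (X t \<omega> \<bullet> u))" using indep_var_integrable[OF ind i] .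
  show "expectation (\<lambda>\<omega>. \<epsilon> s \<omega> * (X t \<omega> \<bullet> u)) = 0"
    using indep_var_lebesgue_integral[OF ind i] eps_mean[OF assms(1)] by simp
qed

lemma residual_product:
  assumes "s \<ge> 1" "t \<ge> 1"
  shows "expectation (\<lambda>\<omega>. (\<epsilon> s \<omega> + X s \<omega> \<bullet> u) * (\<epsilon> t \<omega> + X t \<omega> \<bullet> u)) = noise_cov (lag s t) + regressor_cov u (lag s t)"
proof -
  have "(\<lambda>\<omega>. (\<epsilon> s \<omega> + X s \<omega> \<bullet> u) * (\<epsilon> t \<omega> + X t \<omega> \<bullet> u)) =
    (\<lambda>\<omega>. \<epsilon> s \<omega> * \<epsilon> t \<omega> + (X s \<omega> \<bullet> u) * (X t \<omega> \<bullet> u) + \<epsilon> s \<omega> * (X t \<omega> \<bullet> u) + \<epsilon> t \<omega> * (X s \<omega> \<bullet> u))"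
    by (rule ext) (simp add: algebra_simps)
  then show ?thesis
    using eps_product[OF assms] X_product(1)[OF assms, of u u] X_product(2)[OF assms, of u] cross_product[OF assms, of u]
      cross_product[OF assms(2,1), of u] by simp
qed

text \<open>
  If \<open>u\<close> is the true coefficient minus the candidate, the residual is \<open>\<epsilon> t + X t \<bullet> u\<close>.  Independence of noise and
  regressors makes it Gaussian and adds the two covariance functions.
\<close>

sublocale residual: gaussian_pairs M "\<lambda>t \<omega>. \<epsilon> t \<omega> + X t \<omega> \<bullet> u" "\<sigma>\<^sub>0\<^sup>2 + regressor_cov u 0" for u
proof
  fix s t :: nat and a b :: real assume st: "s \<ge> 1" "t \<ge> 1"
  have "gaussian_rv M (\<lambda>\<omega>. (a * \<epsilon> s \<omega> + b * \<epsilon> t \<omega>) + (a * (X s \<omega> \<bullet> u) + b * (X t \<omega> \<bullet> u)))"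
  proof (rule gaussian_rv_add[OF cross_indep[OF st]])
    show "gaussian_rv M (\<lambda>\<omega>. a * \<epsilon> s \<omega> + b * \<epsilon> t \<omega>)"
      using gaussian_sequence_pair[OF eps_gauss st, of a b] by simp
    show "gaussian_rv M (\<lambda>\<omega>. a * (X s \<omega> \<bullet> u) + b * (X t \<omega> \<bullet> u))"
      using gaussian_sequence_pair[OF X_gauss st, of "a *\<^sub>R u" "b *\<^sub>R u"] by (simp add: inner_commute)
  qed
  then show "gaussian_rv M (\<lambda>\<omega>. a * (\<epsilon> s \<omega> + X s \<omega> \<bullet> u) + b * (\<epsilon> t \<omega> + X t \<omega> \<bullet> u))"
    by (simp add: algebra_simps)
next
  fix t :: nat assume t: "t \<ge> 1"
  show "expectation (\<lambda>\<omega>. \<epsilon> t \<omega> + X t \<omega> \<bullet> u) = 0"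
    using centred_gaussian_moments(1)[OF eps_centred[OF t]] centred_gaussian_moments(1)[OF X_centred[OF t]]
      eps_mean[OF t] X_centred[OF t, of u] by (simp add: centred_gaussian_def)
  have "noise_cov 0 = \<sigma>\<^sub>0\<^sup>2" using eps_var[of 1] by (simp add: noise_cov_def power2_eq_square)
  then show "expectation (\<lambda>\<omega>. (\<epsilon> t \<omega> + X t \<omega> \<bullet> u)\<^sup>2) = \<sigma>\<^sub>0\<^sup>2 + regressor_cov u 0"
    using residual_product[OF t t, of u] by (simp add: power2_eq_square lag_def)
qed

lemma regressor_var_nonneg: "regressor_cov u 0 \<ge> 0"
  using centred_gaussian_var_nonneg[OF X_centred[of 1]] by simp

lemma residual_decorrelates:
  obtains C \<delta> where "decorrelating_pairs M (\<lambda>t \<omega>. \<epsilon> t \<omega> + X t \<omega> \<bullet> u) (\<sigma>\<^sub>0\<^sup>2 + regressor_cov u 0) C \<delta>"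
proof -
  obtain C \<delta> where C: "C \<ge> 0" and \<delta>: "\<delta> > 0"
    and noise_sum: "\<And>n. n \<ge> 1 \<Longrightarrow> (\<Sum>s<n. \<Sum>t<n. noise_cov (lag s t)) \<le> C * real n powr (2 - \<delta>)"
    using noise_sum_bound by blast
  define \<theta>0 where "\<theta>0 = Min (range \<theta>)"
  have \<theta>0: "\<theta>0 \<le> \<theta> i" for i by (simp add: \<theta>0_def)
  have "\<theta>0 \<in> range \<theta>" unfolding \<theta>0_def by (intro Min_in) auto
  then have \<theta>01: "0 < \<theta>0" "\<theta>0 < 1" using \<theta> by auto
  define D where "D = regressor_cov u 0 + (norm u)\<^sup>2"
  have D: "D \<ge> 0" using regressor_var_nonneg[of u] by (simp add: D_def)
  have regressor_le: "\<bar>regressor_cov u k\<bar> \<le> D * (if k = 0 then 1 else real k powr (- \<theta>0))" for k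
    using regressor_decay[of k \<theta>0 u] \<theta>0 regressor_var_nonneg[of u]
    by (cases "k = 0") (auto simp: D_def algebra_simps intro: add_increasing)
  define C' where "C' = C + D * (1 + 2 / (1 - \<theta>0))"
  define \<delta>' where "\<delta>' = min \<delta> \<theta>0"
  have "decorrelating_pairs M (\<lambda>t \<omega>. \<epsilon> t \<omega> + X t \<omega> \<bullet> u) (\<sigma>\<^sub>0\<^sup>2 + regressor_cov u 0) C' \<delta>'"
  proof
    fix n :: nat assume n: "n \<ge> 1"
    have "(\<Sum>s=1..n. \<Sum>t=1..n. \<bar>residual.pair_cov u s t\<bar>) = (\<Sum>s<n. \<Sum>t<n. \<bar>noise_cov (lag s t) + regressor_cov u (lag s t)\<bar>)"
      by (simp add: sum.atLeast1_atMost_eq residual.pair_cov_def residual_product) (simp add: lag_def)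
    also have "\<dots> \<le> (\<Sum>s<n. \<Sum>t<n. noise_cov (lag s t) + D * (if lag s t = 0 then 1 else real (lag s t) powr (- \<theta>0)))"
      using noise_cov_nonneg regressor_le by (intro sum_mono order_trans[OF abs_triangle_ineq] add_mono) auto
    also have "\<dots> = (\<Sum>s<n. \<Sum>t<n. noise_cov (lag s t)) + D * (\<Sum>s<n. \<Sum>t<n. if lag s t = 0 then 1 else real (lag s t) powr (- \<theta>0))"
      by (simp add: sum.distrib sum_distrib_left)
    also have "\<dots> \<le> C * real n powr (2 - \<delta>) + D * ((1 + 2 / (1 - \<theta>0)) * real n powr (2 - \<theta>0))"
      by (intro add_mono mult_left_mono noise_sum lag_sum_powr_bound \<theta>01 n D)
    also have "\<dots> \<le> C * real n powr (2 - \<delta>') + D * ((1 + 2 / (1 - \<theta>0)) * real n powr (2 - \<delta>'))"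
      using n C D \<theta>01 by (intro add_mono mult_left_mono powr_mono) (auto simp: \<delta>'_def)
    also have "\<dots> = C' * real n powr (2 - \<delta>')" by (simp add: C'_def algebra_simps)
    finally show "(\<Sum>s=1..n. \<Sum>t=1..n. \<bar>residual.pair_cov u s t\<bar>) \<le> C' * real n powr (2 - \<delta>')" .
  qed (use \<delta> \<theta>01 in \<open>simp add: \<delta>'_def\<close>)
  then show ?thesis by (rule that)
qed

end

section \<open>The loss function\<close>

text \<open>
  From the assumptions on \<open>\<rho>\<close> the proof extracts that \<open>\<rho>\<close> is bounded, Lipschitz and even, nondecreasing
  in the modulus and strictly increasing near zero.
\<close>

locale bounded_loss =
  fixes \<rho> :: "real \<Rightarrow> real" and c :: real
  assumes rho: "rho_function \<rho> c"
begin

lemma range01: "0 \<le> \<rho> u" "\<rho> u \<le> 1"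
  and even: "\<rho> (- u) = \<rho> u"
  and zero: "\<rho> 0 = 0"
  and c_pos: "c > 0"
  and const: "u \<ge> c \<Longrightarrow> \<rho> u = \<rho> c"
  using rho unfolding rho_function_def by blast+

lemma strict: "0 \<le> x \<Longrightarrow> x < y \<Longrightarrow> y < c \<Longrightarrow> \<rho> x < \<rho> y"
proof -
  assume "0 \<le> x" "x < y" "y < c"
  moreover have "strict_mono_on {0..<c} \<rho>" using rho unfolding rho_function_def by blast
  ultimately show "\<rho> x < \<rho> y" by (intro strict_mono_onD[of "{0..<c}" \<rho>]) auto
qed

lemma derivative_exists:
  obtains D where "\<And>x. (\<rho> has_real_derivative D x) (at x)" "continuous_on UNIV D"
proof -
  have "\<rho> C1_differentiable_on UNIV" using rho unfolding rho_function_def by blast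
  then show ?thesis
    using that by (auto simp: C1_differentiable_on_def has_real_derivative_iff_has_vector_derivative)
qed

lemma cont: "isCont \<rho> x"
  using derivative_exists DERIV_isCont by metis

lemma meas[measurable]: "\<rho> \<in> borel_measurable borel"
  by (intro borel_measurable_continuous_onI continuous_at_imp_continuous_on) (auto intro: cont)

lemma abs: "\<rho> \<bar>x\<bar> = \<rho> x"
  using even by (simp add: abs_if)

lemma mono_nonneg: assumes "0 \<le> x" "x \<le> y" shows "\<rho> x \<le> \<rho> y"
proof -
  have below: "\<rho> x \<le> \<rho> c" if "x < c"
  proof (rule tendsto_lowerbound)
    show "(\<rho> \<longlongrightarrow> \<rho> c) (at_left c)"
      using cont[of c] by (simp add: isCont_def filterlim_at_split)
    have "\<forall>\<^sub>F z in at_left c. z \<in> {x<..<c}" by (intro eventually_at_leftI[of x]) (use that in auto)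
    then show "\<forall>\<^sub>F z in at_left c. \<rho> x \<le> \<rho> z"
      by eventually_elim (use strict[OF assms(1)] in \<open>auto intro: less_imp_le\<close>)
  qed simp
  show ?thesis
  proof (cases "y < c")
    case True
    then show ?thesis using strict[OF assms(1), of y] assms(2) by (cases "x = y") auto
  next
    case False
    then show ?thesis using below const[of x] const[of y] by (cases "x < c") auto
  qed
qed

lemma mono_abs: "\<bar>x\<bar> \<le> \<bar>y\<bar> \<Longrightarrow> \<rho> x \<le> \<rho> y"
  using mono_nonneg[of "\<bar>x\<bar>" "\<bar>y\<bar>"] by (simp add: abs)

text \<open>
  Beyond \<open>\<plusminus> c\<close> the function is constant, so it factors through the projection onto \<open>{-c..c}\<close>, where
  the continuous derivative is bounded.
\<close>

lemma lipschitz: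
  obtains B where "B > 0" "\<And>x y. \<bar>\<rho> x - \<rho> y\<bar> \<le> B * \<bar>x - y\<bar>"
proof -
  obtain D where D: "\<And>x. (\<rho> has_real_derivative D x) (at x)" "continuous_on UNIV D"
    using derivative_exists by blast
  have "bounded (D ` {-c..c})"
    by (intro compact_imp_bounded compact_continuous_image continuous_on_subset[OF D(2)]) auto
  then obtain B where B: "B > 0" "\<And>x. x \<in> {-c..c} \<Longrightarrow> \<bar>D x\<bar> \<le> B"
    unfolding bounded_pos by auto
  define k where "k x = max (- c) (min c x)" for x
  have k: "k x \<in> {-c..c}" for x using c_pos by (auto simp: k_def)
  have \<rho>k: "\<rho> x = \<rho> (k x)" for x
  proof (cases "\<bar>x\<bar> \<le> c")
    case True
    then have "k x = x" by (auto simp: k_def)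
    then show ?thesis by simp
  next
    case False
    then have "\<rho> \<bar>x\<bar> = \<rho> c" by (intro const) auto
    moreover have "\<bar>k x\<bar> = c" using False c_pos by (auto simp: k_def)
    ultimately show ?thesis using abs[of x] abs[of "k x"] by simp
  qed
  have "\<bar>\<rho> x - \<rho> y\<bar> \<le> B * \<bar>x - y\<bar>" for x y
  proof -
    have "norm (\<rho> (k x) - \<rho> (k y)) \<le> B * norm (k x - k y)"
      by (rule field_differentiable_bound[of "{-c..c}" \<rho> D])
        (use B k in \<open>auto intro: has_field_derivative_at_within D\<close>)
    also have "\<dots> \<le> B * \<bar>x - y\<bar>" using B by (intro mult_left_mono) (auto simp: k_def)
    finally show ?thesis by (simp flip: \<rho>k)
  qed
  then show ?thesis using B by (intro that)
qed

text \<open>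
  The mean loss of a centred normal variable with standard deviation \<open>\<tau>\<close>.
\<close>

definition normal_mean where "normal_mean \<tau> = (\<integral>x. \<rho> (\<tau> * x) \<partial>std_normal_distribution)"

lemma normal_integrable: "integrable std_normal_distribution (\<lambda>x. \<rho> (\<tau> * x))"
proof -
  interpret N: real_distribution std_normal_distribution by (rule real_dist_normal_dist)
  show ?thesis by (rule N.integrable_const_bound[where B=1]) (auto simp: range01)
qed

lemma scale_mono: "0 \<le> \<tau> \<Longrightarrow> \<tau> \<le> \<tau>' \<Longrightarrow> \<rho> (\<tau> * x) \<le> \<rho> (\<tau>' * x)"
  by (intro mono_abs) (simp add: abs_mult mult_right_mono)

lemma normal_mean_mono: "0 \<le> \<tau> \<Longrightarrow> \<tau> \<le> \<tau>' \<Longrightarrow> normal_mean \<tau> \<le> normal_mean \<tau>'"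
  unfolding normal_mean_def by (intro integral_mono normal_integrable scale_mono)

text \<open>
  The integrand grows strictly for \<open>0 < x < c / \<tau>'\<close>, an interval of positive normal measure.
\<close>

lemma normal_mean_strict_mono:
  assumes "0 \<le> \<tau>" "\<tau> < \<tau>'"
  shows "normal_mean \<tau> < normal_mean \<tau>'"
proof (rule ccontr)
  assume "\<not> ?thesis"
  then have "(\<integral>x. \<rho> (\<tau>' * x) - \<rho> (\<tau> * x) \<partial>std_normal_distribution) = 0"
    using normal_mean_mono[of \<tau> \<tau>'] assms normal_integrable by (simp add: normal_mean_def)
  then have "AE x in std_normal_distribution. \<rho> (\<tau>' * x) - \<rho> (\<tau> * x) = 0"
    using assms normal_integrable scale_mono[of \<tau> \<tau>']
    by (subst (asm) integral_nonneg_eq_0_iff_AE) auto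
  then have "AE x in lborel. \<rho> (\<tau>' * x) - \<rho> (\<tau> * x) = 0"
    by (subst (asm) AE_density) (auto simp: normal_density_pos)
  then have "AE x in lborel. \<not> (0 < x \<and> x < c / \<tau>')"
  proof eventually_elim
    case (elim x)
    then show ?case using strict[of "\<tau> * x" "\<tau>' * x"] assms by (auto simp: field_simps)
  qed
  then have "emeasure lborel {x \<in> space lborel. 0 < x \<and> x < c / \<tau>'} = 0" by (rule emeasure_eq_0_AE)
  moreover have "{x \<in> space lborel. 0 < x \<and> x < c / \<tau>'} = {0<..<c / \<tau>'}" by auto
  ultimately show False using c_pos assms by simp
qed

end

section \<open>Segment sums, uniformly in the parameter\<close>

text \<open>
  Convergence of averages is uniform over prefixes on the scale of \<open>n\<close>.  Differences of prefixes then
  give the same control over every segment, which is what an unknown break point requires.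
\<close>

lemma prefix_deviation:
  fixes a :: "nat \<Rightarrow> real"
  assumes lim: "(\<lambda>n. a n / real n) \<longlonglongrightarrow> m" and \<eta>: "\<eta> > 0"
  shows "\<forall>\<^sub>F n in sequentially. \<forall>j\<le>n. \<bar>a j - real j * m\<bar> \<le> \<eta> * real n"
proof -
  obtain N where N: "\<And>j. j \<ge> N \<Longrightarrow> \<bar>a j / real j - m\<bar> < \<eta>"
    using LIMSEQ_D[OF lim \<eta>] by auto
  define A where "A = (\<Sum>j\<le>N. \<bar>a j - real j * m\<bar>)"
  have "\<forall>\<^sub>F n in sequentially. A / \<eta> \<le> real n"
    using filterlim_real_sequentially by (auto simp: filterlim_at_top)
  then show ?thesis
  proof eventually_elim
    case (elim n)
    show ?case
    proof (intro allI impI)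
      fix j assume j: "j \<le> n"
      show "\<bar>a j - real j * m\<bar> \<le> \<eta> * real n"
      proof (cases "j \<le> N")
        case True
        then have "\<bar>a j - real j * m\<bar> \<le> A" unfolding A_def by (intro member_le_sum) auto
        also have "\<dots> \<le> \<eta> * real n" using elim \<eta> by (simp add: field_simps)
        finally show ?thesis .
      next
        case False
        then have "a j - real j * m = real j * (a j / real j - m)" by (simp add: right_diff_distrib)
        then have "\<bar>a j - real j * m\<bar> = real j * \<bar>a j / real j - m\<bar>" by (simp add: abs_mult)
        also have "\<dots> \<le> real j * \<eta>" using N[of j] False by (intro mult_left_mono) auto
        also have "\<dots> \<le> \<eta> * real n" using j \<eta> by simp
        finally show ?thesis .
      qed
    qed
  qed
qed

lemma sum_split_at: "i \<le> j \<Longrightarrow> j \<le> k \<Longrightarrow> (\<Sum>t=i+1..k. f t) = (\<Sum>t=i+1..j. f t) + (\<Sum>t=j+1..k. f t)"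
  for f :: "nat \<Rightarrow> real"
proof -
  assume "i \<le> j" "j \<le> k"
  then have "{i+1..k} = {i+1..j} \<union> {j+1..k}" by auto
  then show ?thesis by (simp add: sum.union_disjoint)
qed

text \<open>
  A finite net in \<open>Q\<close> reduces the uniformity in \<open>u\<close> to finitely many averages: moving \<open>u\<close> by \<open>r\<close> changes
  a term by at most \<open>B * r * norm (x t)\<close>, and the norms have bounded averages.
\<close>

lemma uniform_segment_lower_bound:
  fixes x :: "nat \<Rightarrow> 'b::euclidean_space" and e :: "nat \<Rightarrow> real" and \<phi> :: "real \<Rightarrow> real"
  assumes lip: "\<And>y z. \<bar>\<phi> y - \<phi> z\<bar> \<le> B * \<bar>y - z\<bar>" and B: "B > 0"
    and U: "compact U" and Q: "\<And>V. open V \<Longrightarrow> V \<noteq> {} \<Longrightarrow> \<exists>q\<in>Q. q \<in> V"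
    and lim: "\<And>q. q \<in> Q \<Longrightarrow> \<exists>m\<ge>l. (\<lambda>n. (\<Sum>t=1..n. \<phi> (e t + x t \<bullet> q)) / real n) \<longlonglongrightarrow> m"
    and A: "A > 0" "\<And>n. (\<Sum>t=1..n. norm (x t)) \<le> A * real n"
    and \<eta>: "\<eta> > 0"
  shows "\<forall>\<^sub>F n in sequentially. \<forall>u\<in>U. \<forall>i j. i \<le> j \<longrightarrow> j \<le> n \<longrightarrow>
     real (j - i) * l - \<eta> * real n \<le> (\<Sum>t=i+1..j. \<phi> (e t + x t \<bullet> u))"
proof -
  define r where "r = \<eta> / (2 * A * B)"
  have r: "r > 0" using \<eta> A B by (simp add: r_def)
  have "U \<subseteq> (\<Union>q\<in>Q. ball q r)"
  proof
    fix u
    obtain q where "q \<in> Q" "q \<in> ball u r" using Q[of "ball u r"] r by auto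
    then show "u \<in> (\<Union>q\<in>Q. ball q r)" by (auto simp: dist_commute)
  qed
  then obtain F where F: "F \<subseteq> Q" "finite F" "U \<subseteq> (\<Union>q\<in>F. ball q r)"
    using compactE_image[OF U, of Q "\<lambda>q. ball q r"] by auto
  define S where "S q n = (\<Sum>t=1..n. \<phi> (e t + x t \<bullet> q))" for q n
  have "\<exists>m\<ge>l. (\<lambda>n. S q n / real n) \<longlonglongrightarrow> m" if "q \<in> F" for q
    using lim[of q] F that by (auto simp: S_def)
  then obtain m where m: "\<And>q. q \<in> F \<Longrightarrow> m q \<ge> l" "\<And>q. q \<in> F \<Longrightarrow> (\<lambda>n. S q n / real n) \<longlonglongrightarrow> m q"
    by metis
  have "\<forall>\<^sub>F n in sequentially. \<forall>q\<in>F. \<forall>j\<le>n. \<bar>S q j - real j * m q\<bar> \<le> (\<eta> / 4) * real n"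
    using F(2) \<eta> by (intro eventually_ball_finite ballI prefix_deviation m) auto
  then show ?thesis
  proof eventually_elim
    case (elim n)
    show ?case
    proof (intro ballI allI impI)
      fix u i j assume u: "u \<in> U" and ij: "i \<le> j" "j \<le> n"
      obtain q where q: "q \<in> F" "u \<in> ball q r" using F u by auto
      have dev: "\<bar>S q i - real i * m q\<bar> \<le> (\<eta> / 4) * real n" "\<bar>S q j - real j * m q\<bar> \<le> (\<eta> / 4) * real n"
        using elim q ij by auto
      have "S q j = S q i + (\<Sum>t=i+1..j. \<phi> (e t + x t \<bullet> q))"
        unfolding S_def using sum_split_at[of 0 i j] ij by simp
      moreover have "real (j - i) * l \<le> real (j - i) * m q" using m(1)[OF q(1)] by (intro mult_left_mono) auto
      moreover have "real (j - i) * m q = real j * m q - real i * m q"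
        using ij by (simp add: of_nat_diff algebra_simps)
      ultimately have 1: "real (j - i) * l - \<eta> / 2 * real n \<le> (\<Sum>t=i+1..j. \<phi> (e t + x t \<bullet> q))"
        using dev by linarith
      have "(\<Sum>t=i+1..j. \<phi> (e t + x t \<bullet> q)) - (\<Sum>t=i+1..j. \<phi> (e t + x t \<bullet> u))
          \<le> (\<Sum>t=i+1..j. B * r * norm (x t))"
        unfolding sum_subtractf[symmetric]
      proof (rule sum_mono)
        fix t
        have "\<phi> (e t + x t \<bullet> q) - \<phi> (e t + x t \<bullet> u) \<le> B * \<bar>(e t + x t \<bullet> q) - (e t + x t \<bullet> u)\<bar>"
          using lip[of "e t + x t \<bullet> q" "e t + x t \<bullet> u"] by linarith
        also have "(e t + x t \<bullet> q) - (e t + x t \<bullet> u) = x t \<bullet> (q - u)" by (simp add: inner_diff_right)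
        also have "B * \<bar>x t \<bullet> (q - u)\<bar> \<le> B * (norm (x t) * norm (q - u))"
          using B by (intro mult_left_mono Cauchy_Schwarz_ineq2) auto
        also have "\<dots> \<le> B * (norm (x t) * r)"
          using q B by (intro mult_left_mono) (auto simp: dist_norm)
        finally show "\<phi> (e t + x t \<bullet> q) - \<phi> (e t + x t \<bullet> u) \<le> B * r * norm (x t)" by (simp add: ac_simps)
      qed
      also have "\<dots> = B * r * (\<Sum>t=i+1..j. norm (x t))" by (simp add: sum_distrib_left)
      also have "\<dots> \<le> B * r * (A * real n)"
      proof -
        have "(\<Sum>t=i+1..j. norm (x t)) \<le> (\<Sum>t=1..n. norm (x t))" using ij by (intro sum_mono2) auto
        then show ?thesis using A(2)[of n] B r by (intro mult_left_mono) auto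
      qed
      also have "\<dots> = \<eta> / 2 * real n" using A B by (simp add: r_def)
      finally show "real (j - i) * l - \<eta> * real n \<le> (\<Sum>t=i+1..j. \<phi> (e t + x t \<bullet> u))" using 1 by linarith
    qed
  qed
qed

section \<open>The scale of the S-estimator\<close>

lemma break_index_le: "0 \<le> p \<Longrightarrow> p \<le> 1 \<Longrightarrow> break_index n p \<le> n"
proof -
  assume "0 \<le> p" "p \<le> 1"
  then have "real n * p \<le> real n" by (simp add: mult_left_le)
  then have "\<lfloor>real n * p\<rfloor> \<le> int n" by linarith
  then show ?thesis by (simp add: break_index_def)
qed

text \<open>
  The left-hand side of the equation that defines the scale, as one average over the sample.
\<close>

definition mean_loss ::
    "(real \<Rightarrow> real) \<Rightarrow> (nat \<Rightarrow> real) \<Rightarrow> (nat \<Rightarrow> real ^ 'd) \<Rightarrow> nat \<Rightarrow> real ^ 'd \<Rightarrow> real ^ 'd \<Rightarrow> real \<Rightarrow> real \<Rightarrow> real" where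
  "mean_loss \<rho> y x n b1 b2 p s =
    ((\<Sum>t = 1..break_index n p. \<rho> (residual y x b1 t / s)) +
     (\<Sum>t = break_index n p + 1..n. \<rho> (residual y x b2 t / s))) / real n"

lemma scale_solutions_eq:
  "scale_solutions \<rho> K y x n b1 b2 p = {s. s > 0 \<and> mean_loss \<rho> y x n b1 b2 p s = K}"
  by (simp add: scale_solutions_def mean_loss_def add_divide_distrib)

context bounded_loss
begin

lemma mean_loss_antimono:
  assumes "0 < s" "s \<le> s'"
  shows "mean_loss \<rho> y x n b1 b2 p s' \<le> mean_loss \<rho> y x n b1 b2 p s"
proof -
  have "\<rho> (z / s') \<le> \<rho> (z / s)" for z
    using scale_mono[of "1 / s'" "1 / s" z] assms by (simp add: frac_le)
  then show ?thesis unfolding mean_loss_def by (intro divide_right_mono add_mono sum_mono) auto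
qed

text \<open>
  As \<open>s\<close> grows all standardised residuals tend to zero, and \<open>\<rho>\<close> is below \<open>K\<close> near zero.  Boundedness is
  needed because the scale is a supremum of reals.
\<close>

lemma scale_solutions_bdd_above:
  assumes K: "K > 0" and n: "n \<ge> 1" and p: "p \<in> {0..1}"
  shows "bdd_above (scale_solutions \<rho> K y x n b1 b2 p)"
proof -
  let ?k = "break_index n p"
  obtain d where d: "d > 0" "\<And>z. \<bar>z\<bar> < d \<Longrightarrow> \<rho> z < K"
    using order_tendstoD(2)[OF isContD[OF cont[of 0]], of K] K cont[of 0] zero
    unfolding eventually_at by (auto simp: dist_real_def) (metis)
  define R where "R = (\<Sum>t=1..n. \<bar>residual y x b1 t\<bar> + \<bar>residual y x b2 t\<bar>)"
  have R: "\<bar>residual y x b1 t\<bar> \<le> R" "\<bar>residual y x b2 t\<bar> \<le> R" if "1 \<le> t" "t \<le> n" for t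
    using member_le_sum[of t "{1..n}" "\<lambda>t. \<bar>residual y x b1 t\<bar> + \<bar>residual y x b2 t\<bar>"] that
    by (auto simp: R_def intro: order_trans[rotated])
  have k: "?k \<le> n" using p by (intro break_index_le) auto
  have "s \<le> R / d" if s: "s > 0" "mean_loss \<rho> y x n b1 b2 p s = K" for s
  proof (rule ccontr)
    assume "\<not> s \<le> R / d"
    then have small: "\<rho> (z / s) < K" if "\<bar>z\<bar> \<le> R" for z
      using that s d(1) by (intro d(2)) (auto simp: field_simps)
    have "(\<Sum>t=1..n. \<rho> (residual y x (if t \<le> ?k then b1 else b2) t / s)) < (\<Sum>t=1..n. K)"
      using n R by (intro sum_strict_mono small) auto
    also have "(\<Sum>t=1..n. \<rho> (residual y x (if t \<le> ?k then b1 else b2) t / s)) =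
        (\<Sum>t = 1..?k. \<rho> (residual y x b1 t / s)) + (\<Sum>t = ?k + 1..n. \<rho> (residual y x b2 t / s))"
      using sum_split_at[of 0 ?k n "\<lambda>t. \<rho> (residual y x (if t \<le> ?k then b1 else b2) t / s)"] k by simp
    finally show False using s n by (simp add: mean_loss_def field_simps)
  qed
  then show ?thesis unfolding scale_solutions_eq by (intro bdd_aboveI[of _ "R / d"]) auto
qed

text \<open>
  The true and the candidate break cut the sample into at most three segments on which the residual is
  \<open>e t + x t \<bullet> u\<close> with a fixed \<open>u\<close>.  Splitting each of the two sums at the true break gives four
  segments, at least one of them empty, and avoids a distinction which break comes first.
\<close>

lemma mean_loss_lower_bound:
  fixes x :: "nat \<Rightarrow> real ^ 'd"
  assumes seg: "\<And>u i j. u \<in> {b - b' |b b'. b \<in> Y \<and> b' \<in> Y} \<Longrightarrow> i \<le> j \<Longrightarrow> j \<le> n \<Longrightarrow>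
      real (j - i) * l - \<eta> * real n \<le> (\<Sum>t=i+1..j. \<rho> ((e t + x t \<bullet> u) / s))"
    and \<beta>: "\<beta>1 \<in> Y" "\<beta>2 \<in> Y" and b: "b1 \<in> Y" "b2 \<in> Y"
    and p: "0 \<le> p" "p \<le> 1" and p0: "0 \<le> p0" "p0 \<le> 1" and n: "n \<ge> 1"
  shows "l - 4 * \<eta> \<le> mean_loss \<rho> (response x e \<beta>1 \<beta>2 p0 n) x n b1 b2 p s"
proof -
  define y where "y = response x e \<beta>1 \<beta>2 p0 n"
  define k where "k = break_index n p"
  define k0 where "k0 = break_index n p0"
  have k: "k \<le> n" "k0 \<le> n" using break_index_le p p0 by (auto simp: k_def k0_def)
  have res1: "residual y x b' t = e t + x t \<bullet> (\<beta>1 - b')" if "1 \<le> t" "t \<le> k0" for b' t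
    using that by (simp add: y_def residual_def response_def k0_def inner_diff_right)
  have res2: "residual y x b' t = e t + x t \<bullet> (\<beta>2 - b')" if "k0 + 1 \<le> t" "t \<le> n" for b' t
    using that by (simp add: y_def residual_def response_def k0_def inner_diff_right)
  have "(\<Sum>t=1..k. \<rho> (residual y x b1 t / s)) =
      (\<Sum>t=0+1..min k k0. \<rho> (residual y x b1 t / s)) + (\<Sum>t=min k k0+1..k. \<rho> (residual y x b1 t / s))"
    using sum_split_at[of 0 "min k k0" k] by simp
  also have "(\<Sum>t=0+1..min k k0. \<rho> (residual y x b1 t / s)) = (\<Sum>t=0+1..min k k0. \<rho> ((e t + x t \<bullet> (\<beta>1 - b1)) / s))"
    by (rule sum.cong) (auto simp: res1)
  also have "(\<Sum>t=min k k0+1..k. \<rho> (residual y x b1 t / s)) = (\<Sum>t=min k k0+1..k. \<rho> ((e t + x t \<bullet> (\<beta>2 - b1)) / s))"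
    using k by (intro sum.cong) (auto simp: res2 min_def split: if_splits)
  finally have s1: "(\<Sum>t=1..k. \<rho> (residual y x b1 t / s)) =
      (\<Sum>t=0+1..min k k0. \<rho> ((e t + x t \<bullet> (\<beta>1 - b1)) / s)) +
      (\<Sum>t=min k k0+1..k. \<rho> ((e t + x t \<bullet> (\<beta>2 - b1)) / s))" .
  have "(\<Sum>t=k+1..n. \<rho> (residual y x b2 t / s)) =
      (\<Sum>t=k+1..max k k0. \<rho> (residual y x b2 t / s)) + (\<Sum>t=max k k0+1..n. \<rho> (residual y x b2 t / s))"
    using sum_split_at[of k "max k k0" n] k by simp
  also have "(\<Sum>t=k+1..max k k0. \<rho> (residual y x b2 t / s)) = (\<Sum>t=k+1..max k k0. \<rho> ((e t + x t \<bullet> (\<beta>1 - b2)) / s))"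
    by (rule sum.cong) (auto simp: res1 max_def split: if_splits)
  also have "(\<Sum>t=max k k0+1..n. \<rho> (residual y x b2 t / s)) = (\<Sum>t=max k k0+1..n. \<rho> ((e t + x t \<bullet> (\<beta>2 - b2)) / s))"
    by (rule sum.cong) (auto simp: res2)
  finally have s2: "(\<Sum>t=k+1..n. \<rho> (residual y x b2 t / s)) =
      (\<Sum>t=k+1..max k k0. \<rho> ((e t + x t \<bullet> (\<beta>1 - b2)) / s)) +
      (\<Sum>t=max k k0+1..n. \<rho> ((e t + x t \<bullet> (\<beta>2 - b2)) / s))" .
  have U: "\<beta>1 - b1 \<in> {b - b' |b b'. b \<in> Y \<and> b' \<in> Y}" "\<beta>2 - b1 \<in> {b - b' |b b'. b \<in> Y \<and> b' \<in> Y}"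
    "\<beta>1 - b2 \<in> {b - b' |b b'. b \<in> Y \<and> b' \<in> Y}" "\<beta>2 - b2 \<in> {b - b' |b b'. b \<in> Y \<and> b' \<in> Y}"
    using \<beta> b by blast+
  have len: "real (min k k0 - 0) * l + real (k - min k k0) * l + real (max k k0 - k) * l + real (n - max k k0) * l = real n * l"
  proof -
    have "real (min k k0 - 0) + real (k - min k k0) + real (max k k0 - k) + real (n - max k k0) = real n"
      using k by (simp add: of_nat_diff)
    then show ?thesis by (metis distrib_right)
  qed
  have "real n * l - 4 * \<eta> * real n \<le>
      (\<Sum>t=1..k. \<rho> (residual y x b1 t / s)) + (\<Sum>t=k+1..n. \<rho> (residual y x b2 t / s))"
  proof -
    have "real (min k k0 - 0) * l - \<eta> * real n \<le> (\<Sum>t=0+1..min k k0. \<rho> ((e t + x t \<bullet> (\<beta>1 - b1)) / s))"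
      by (rule seg[OF U(1)]) (use k in auto)
    moreover have "real (k - min k k0) * l - \<eta> * real n \<le> (\<Sum>t=min k k0+1..k. \<rho> ((e t + x t \<bullet> (\<beta>2 - b1)) / s))"
      by (rule seg[OF U(2)]) (use k in auto)
    moreover have "real (max k k0 - k) * l - \<eta> * real n \<le> (\<Sum>t=k+1..max k k0. \<rho> ((e t + x t \<bullet> (\<beta>1 - b2)) / s))"
      by (rule seg[OF U(3)]) (use k in auto)
    moreover have "real (n - max k k0) * l - \<eta> * real n \<le> (\<Sum>t=max k k0+1..n. \<rho> ((e t + x t \<bullet> (\<beta>2 - b2)) / s))"
      by (rule seg[OF U(4)]) (use k in auto)
    ultimately show ?thesis unfolding s1 s2 using len by linarith
  qed
  then show ?thesis
    using n unfolding y_def[symmetric] mean_loss_def k_def[symmetric]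
    by (simp add: field_simps)
qed

text \<open>
  The two-stage minimisation still yields a global minimum: the profile at \<open>p\<close> lies below the value at any
  \<open>(b1, b2, p)\<close>.
\<close>

lemma S_estimator_bounds:
  assumes est: "is_S_estimator \<rho> K y x n Y bt1 bt2 ph" and "b1 \<in> Y" "b2 \<in> Y" "0 \<le> p" "p \<le> 1"
  shows "bt1 ph \<in> Y" "bt2 ph \<in> Y" "ph \<in> {0..1}"
    and "s_scale \<rho> K y x n (bt1 ph) (bt2 ph) ph \<le> s_scale \<rho> K y x n b1 b2 p"
proof -
  have inner: "is_arg_min (\<lambda>(b1, b2). s_scale \<rho> K y x n b1 b2 q) (\<lambda>b. b \<in> Y \<times> Y) (bt1 q, bt2 q)"
    if "q \<in> {0..1}" for q
    using est that unfolding is_S_estimator_def by blast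
  have outer: "is_arg_min (\<lambda>p. s_scale \<rho> K y x n (bt1 p) (bt2 p) p) (\<lambda>p. p \<in> {0..1}) ph"
    using est unfolding is_S_estimator_def by blast
  show ph: "ph \<in> {0..1}" using outer by (simp add: is_arg_min_def)
  show "bt1 ph \<in> Y" "bt2 ph \<in> Y" using inner[OF ph] by (auto simp: is_arg_min_def)
  have p: "p \<in> {0..1}" using assms by simp
  have "s_scale \<rho> K y x n (bt1 ph) (bt2 ph) ph \<le> s_scale \<rho> K y x n (bt1 p) (bt2 p) p"
    using outer p by (auto simp: is_arg_min_linorder)
  also have "\<dots> \<le> s_scale \<rho> K y x n b1 b2 p"
    using inner[OF p] assms(2,3) by (auto simp: is_arg_min_linorder)
  finally show "s_scale \<rho> K y x n (bt1 ph) (bt2 ph) ph \<le> s_scale \<rho> K y x n b1 b2 p" .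
qed

text \<open>
  At the true parameter both segments leave the noise as residual.
\<close>

lemma mean_loss_at_truth:
  assumes p: "0 \<le> p" "p \<le> 1"
  shows "mean_loss \<rho> (response x e \<beta>1 \<beta>2 p n) x n \<beta>1 \<beta>2 p s = (\<Sum>t=1..n. \<rho> (e t / s)) / real n"
proof -
  define k where "k = break_index n p"
  have k: "k \<le> n" using break_index_le p by (simp add: k_def)
  have "(\<Sum>t=1..k. \<rho> (residual (response x e \<beta>1 \<beta>2 p n) x \<beta>1 t / s)) = (\<Sum>t=1..k. \<rho> (e t / s))"
    by (rule sum.cong) (auto simp: residual_def response_def k_def)
  moreover have "(\<Sum>t=k+1..n. \<rho> (residual (response x e \<beta>1 \<beta>2 p n) x \<beta>2 t / s)) = (\<Sum>t=k+1..n. \<rho> (e t / s))"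
    by (rule sum.cong) (auto simp: residual_def response_def k_def)
  ultimately show ?thesis
    using sum_split_at[of 0 k n "\<lambda>t. \<rho> (e t / s)"] k by (simp add: mean_loss_def k_def[symmetric])
qed

text \<open>
  The estimated scale is at most the scale at the true parameter, where the averages of
  \<open>\<rho> (e t / s)\<close> fall below \<open>K\<close> for each \<open>s > \<sigma>\<close>.  For \<open>s < \<sigma>\<close> the limiting mean loss at every parameter is at least
  \<open>normal_mean (\<sigma> / s) > K\<close>, because a parameter error only adds the variance \<open>v u\<close>; by the uniform
  bound no candidate can have a solution below \<open>s\<close>.
\<close>

lemma consistency_on_path:
  fixes x :: "nat \<Rightarrow> real ^ 'd" and e :: "nat \<Rightarrow> real" and v :: "real ^ 'd \<Rightarrow> real"
  assumes Y: "compact Y" and \<beta>: "\<beta>1 \<in> Y" "\<beta>2 \<in> Y" and p0: "0 \<le> p0" "p0 \<le> 1" and \<sigma>: "\<sigma> > 0"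
    and Q: "\<And>V. open V \<Longrightarrow> V \<noteq> {} \<Longrightarrow> \<exists>q\<in>Q. q \<in> V" and Q0: "0 \<in> Q"
    and v: "\<And>u. v u \<ge> 0" "v 0 = 0"
    and avg: "\<And>u f F. u \<in> Q \<Longrightarrow> (\<And>z. isCont f z) \<Longrightarrow> (\<And>z. \<bar>f z\<bar> \<le> F) \<Longrightarrow>
      (\<lambda>n. (\<Sum>t=1..n. f (e t + x t \<bullet> u)) / real n) \<longlonglongrightarrow>
        (\<integral>z. f (sqrt (\<sigma>\<^sup>2 + v u) * z) \<partial>std_normal_distribution)"
    and A: "A > 0" "\<And>n. (\<Sum>t=1..n. norm (x t)) \<le> A * real n"
    and K: "K = normal_mean 1"
    and solvable: "\<forall>\<^sub>F n in sequentially. scale_solvable \<rho> K (response x e \<beta>1 \<beta>2 p0 n) x n Y"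
    and est: "\<And>n. scale_solvable \<rho> K (response x e \<beta>1 \<beta>2 p0 n) x n Y \<Longrightarrow>
      is_S_estimator \<rho> K (response x e \<beta>1 \<beta>2 p0 n) x n Y (bt1 n) (bt2 n) (ph n)"
  shows "(\<lambda>n. s_scale \<rho> K (response x e \<beta>1 \<beta>2 p0 n) x n (bt1 n (ph n)) (bt2 n (ph n)) (ph n)) \<longlonglongrightarrow> \<sigma>"
proof -
  let ?y = "response x e \<beta>1 \<beta>2 p0"
  let ?S = "\<lambda>n. s_scale \<rho> K (?y n) x n (bt1 n (ph n)) (bt2 n (ph n)) (ph n)"
  have K_pos: "K > 0"
    using normal_mean_strict_mono[of 0 1] by (simp add: K normal_mean_def zero)
  have rho_avg: "(\<lambda>n. (\<Sum>t=1..n. \<rho> ((e t + x t \<bullet> u) / s)) / real n) \<longlonglongrightarrow> normal_mean (sqrt (\<sigma>\<^sup>2 + v u) / s)"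
    if "u \<in> Q" "s > 0" for u s
  proof -
    have "isCont (\<lambda>z. \<rho> (z / s)) z" for z
      using that by (intro isCont_o2[OF _ cont]) (auto intro!: continuous_intros)
    from avg[OF that(1) this, of 1] show ?thesis
      by (simp add: range01 normal_mean_def)
  qed
  have upper: "\<forall>\<^sub>F n in sequentially. ?S n \<le> s" if s: "s > \<sigma>" for s
  proof -
    have "normal_mean (\<sigma> / s) < K" unfolding K using s \<sigma> by (intro normal_mean_strict_mono) auto
    moreover have "(\<lambda>n. (\<Sum>t=1..n. \<rho> (e t / s)) / real n) \<longlonglongrightarrow> normal_mean (\<sigma> / s)"
      using rho_avg[OF Q0, of s] s \<sigma> v(2) by simp
    ultimately have "\<forall>\<^sub>F n in sequentially. (\<Sum>t=1..n. \<rho> (e t / s)) / real n < K"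
      by (intro order_tendstoD(2))
    then show ?thesis using solvable
    proof eventually_elim
      case (elim n)
      have "?S n \<le> s_scale \<rho> K (?y n) x n \<beta>1 \<beta>2 p0"
        by (rule S_estimator_bounds(4)[OF est[OF elim(2)] \<beta> p0])
      also have "\<dots> \<le> s" unfolding s_scale_def
      proof (rule cSup_least)
        show "scale_solutions \<rho> K (?y n) x n \<beta>1 \<beta>2 p0 \<noteq> {}"
          using elim(2) \<beta> p0 by (simp add: scale_solvable_def)
        fix s' assume "s' \<in> scale_solutions \<rho> K (?y n) x n \<beta>1 \<beta>2 p0"
        then have s': "mean_loss \<rho> (?y n) x n \<beta>1 \<beta>2 p0 s' = K" by (simp add: scale_solutions_eq)
        show "s' \<le> s"
        proof (rule ccontr)
          assume "\<not> s' \<le> s"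
          then have "mean_loss \<rho> (?y n) x n \<beta>1 \<beta>2 p0 s' \<le> mean_loss \<rho> (?y n) x n \<beta>1 \<beta>2 p0 s"
            using s \<sigma> by (intro mean_loss_antimono) auto
          then show False using elim(1) s' by (simp add: mean_loss_at_truth[OF p0])
        qed
      qed
      finally show ?case .
    qed
  qed
  have lower: "\<forall>\<^sub>F n in sequentially. s \<le> ?S n" if s: "0 < s" "s < \<sigma>" for s
  proof -
    define l where "l = normal_mean (\<sigma> / s)"
    have l: "K < l" unfolding K l_def using s by (intro normal_mean_strict_mono) auto
    \<comment> \<open>four segments lose \<open>\<eta>\<close> each, which leaves half of the gap between \<open>l\<close> and \<open>K\<close>\<close>
    define \<eta> where "\<eta> = (l - K) / 8"
    have \<eta>: "\<eta> > 0" using l by (simp add: \<eta>_def)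
    obtain B where B: "B > 0" "\<And>y z. \<bar>\<rho> y - \<rho> z\<bar> \<le> B * \<bar>y - z\<bar>" using lipschitz by blast
    have lip: "\<bar>\<rho> (y / s) - \<rho> (z / s)\<bar> \<le> B / s * \<bar>y - z\<bar>" for y z
      using B(2)[of "y / s" "z / s"] s by (simp add: diff_divide_distrib[symmetric] abs_divide)
    have limit: "\<exists>m\<ge>l. (\<lambda>n. (\<Sum>t=1..n. \<rho> ((e t + x t \<bullet> q) / s)) / real n) \<longlonglongrightarrow> m" if "q \<in> Q" for q
    proof (intro exI[of _ "normal_mean (sqrt (\<sigma>\<^sup>2 + v q) / s)"] conjI)
      show "(\<lambda>n. (\<Sum>t=1..n. \<rho> ((e t + x t \<bullet> q) / s)) / real n) \<longlonglongrightarrow> normal_mean (sqrt (\<sigma>\<^sup>2 + v q) / s)"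
        by (rule rho_avg[OF that s(1)])
      have "sqrt (\<sigma>\<^sup>2) \<le> sqrt (\<sigma>\<^sup>2 + v q)" using v(1)[of q] by (intro real_sqrt_le_mono) simp
      then have "\<sigma> / s \<le> sqrt (\<sigma>\<^sup>2 + v q) / s" using s \<sigma> by (intro divide_right_mono) auto
      then show "l \<le> normal_mean (sqrt (\<sigma>\<^sup>2 + v q) / s)"
        unfolding l_def using s \<sigma> by (intro normal_mean_mono) auto
    qed
    have "\<forall>\<^sub>F n in sequentially. \<forall>u\<in>{b - b' |b b'. b \<in> Y \<and> b' \<in> Y}. \<forall>i j. i \<le> j \<longrightarrow> j \<le> n \<longrightarrow>
        real (j - i) * l - \<eta> * real n \<le> (\<Sum>t=i+1..j. \<rho> ((e t + x t \<bullet> u) / s))"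
      by (rule uniform_segment_lower_bound[where \<phi>="\<lambda>z. \<rho> (z / s)", OF lip _ compact_differences[OF Y Y] Q limit A \<eta>])
        (use B(1) s(1) in \<open>rule divide_pos_pos\<close>)
    then show ?thesis using solvable eventually_ge_at_top[of 1]
    proof eventually_elim
      case (elim n)
      note b = S_estimator_bounds(1-3)[OF est[OF elim(2)] \<beta> p0]
      let ?sol = "scale_solutions \<rho> K (?y n) x n (bt1 n (ph n)) (bt2 n (ph n)) (ph n)"
      have "?sol \<noteq> {}" using elim(2) b by (simp add: scale_solvable_def)
      then obtain s' where s': "s' \<in> ?sol" by blast
      then have s'0: "s' > 0" and s'K: "mean_loss \<rho> (?y n) x n (bt1 n (ph n)) (bt2 n (ph n)) (ph n) s' = K"
        by (simp_all add: scale_solutions_eq)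
      have "s \<le> s'"
      proof (rule ccontr)
        assume "\<not> s \<le> s'"
        have "l - 4 * \<eta> \<le> mean_loss \<rho> (?y n) x n (bt1 n (ph n)) (bt2 n (ph n)) (ph n) s"
          by (rule mean_loss_lower_bound[OF _ \<beta> b(1,2) _ _ p0 elim(3)]) (use elim(1) b(3) in auto)
        also have "\<dots> \<le> mean_loss \<rho> (?y n) x n (bt1 n (ph n)) (bt2 n (ph n)) (ph n) s'"
          using \<open>\<not> s \<le> s'\<close> s'0 by (intro mean_loss_antimono) auto
        finally have "l - 4 * \<eta> \<le> K" using s'K by simp
        moreover have "8 * \<eta> = l - K" by (simp add: \<eta>_def)
        ultimately show False using l by linarith
      qed
      also have "s' \<le> ?S n" unfolding s_scale_def
        by (rule cSup_upper[OF s' scale_solutions_bdd_above[OF K_pos elim(3) b(3)]])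
      finally show ?case .
    qed
  qed
  show ?thesis
  proof (rule order_tendstoI)
    fix a assume "a < \<sigma>"
    then have "\<forall>\<^sub>F n in sequentially. max ((a + \<sigma>) / 2) (\<sigma> / 2) \<le> ?S n"
      using \<sigma> by (intro lower) (auto simp: less_max_iff_disj)
    then show "\<forall>\<^sub>F n in sequentially. a < ?S n"
      by eventually_elim (use \<open>a < \<sigma>\<close> in auto)
  next
    fix a assume "\<sigma> < a"
    then have "\<forall>\<^sub>F n in sequentially. ?S n \<le> (a + \<sigma>) / 2" by (intro upper) auto
    then show "\<forall>\<^sub>F n in sequentially. ?S n < a"
      by eventually_elim (use \<open>\<sigma> < a\<close> in auto)
  qed
qed

end

text \<open>
  Regressor coordinates are differences of the residual processes at \<open>u = axis i 1\<close> and \<open>u = 0\<close>, so the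
  averages of the squared residual processes also bound the regressors.
\<close>

lemma norm_average_bound:
  fixes x :: "nat \<Rightarrow> real ^ 'd" and e :: "nat \<Rightarrow> real"
  assumes sq: "\<And>u. u \<in> insert 0 (range (\<lambda>i. axis i 1)) \<Longrightarrow>
      (\<lambda>n. (\<Sum>t=1..n. (e t + x t \<bullet> u)\<^sup>2) / real n) \<longlonglongrightarrow> v u"
  obtains A where "A > 0" "\<And>n. (\<Sum>t=1..n. norm (x t)) \<le> A * real n"
proof -
  have "\<exists>B>0. \<forall>n. (\<Sum>t=1..n. \<bar>e t + x t \<bullet> u\<bar>) \<le> B * real n"
    if "u \<in> insert 0 (range (\<lambda>i. axis i 1))" for u :: "real ^ 'd"
    by (rule average_bound_from_squares[OF sq[OF that]]) blast
  then have "\<exists>B. \<forall>u\<in>insert 0 (range (\<lambda>i. axis i 1)) :: (real ^ 'd) set.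
      B u > 0 \<and> (\<forall>n. (\<Sum>t=1..n. \<bar>e t + x t \<bullet> u\<bar>) \<le> B u * real n)"
    by (intro bchoice) blast
  then obtain B where B: "\<And>u. u \<in> insert 0 (range (\<lambda>i. axis i 1)) \<Longrightarrow> B u > 0"
    "\<And>u n. u \<in> insert 0 (range (\<lambda>i. axis i 1)) \<Longrightarrow> (\<Sum>t=1..n. \<bar>e t + x t \<bullet> u\<bar>) \<le> B u * real n"
    by blast
  define A where "A = (\<Sum>i::'d\<in>UNIV. B (axis i 1) + B 0)"
  have "A > 0" unfolding A_def by (intro sum_pos add_pos_pos B) auto
  moreover have "(\<Sum>t=1..n. norm (x t)) \<le> A * real n" for n
  proof -
    have "norm (x t) \<le> (\<Sum>i\<in>UNIV. \<bar>e t + x t \<bullet> axis i 1\<bar> + \<bar>e t + x t \<bullet> 0\<bar>)" for t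
    proof (rule order_trans[OF norm_le_l1_cart], rule sum_mono)
      fix i
      show "\<bar>x t $ i\<bar> \<le> \<bar>e t + x t \<bullet> axis i 1\<bar> + \<bar>e t + x t \<bullet> 0\<bar>"
        using abs_triangle_ineq4[of "e t + x t $ i" "e t"] by (simp add: inner_axis)
    qed
    then have "(\<Sum>t=1..n. norm (x t)) \<le> (\<Sum>t=1..n. \<Sum>i\<in>UNIV. \<bar>e t + x t \<bullet> axis i 1\<bar> + \<bar>e t + x t \<bullet> 0\<bar>)"
      by (rule sum_mono)
    also have "\<dots> = (\<Sum>i\<in>UNIV. (\<Sum>t=1..n. \<bar>e t + x t \<bullet> axis i 1\<bar>) + (\<Sum>t=1..n. \<bar>e t + x t \<bullet> 0\<bar>))"
      by (subst sum.swap) (simp only: sum.distrib)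
    also have "\<dots> \<le> (\<Sum>i\<in>UNIV. B (axis i 1) * real n + B 0 * real n)"
      by (intro sum_mono add_mono B) auto
    also have "\<dots> = A * real n" by (simp add: A_def sum_distrib_right distrib_right)
    finally show ?thesis .
  qed
  ultimately show ?thesis by (rule that)
qed

section \<open>Strong consistency\<close>

lemma (in gaussian_regression) residual_averages:
  assumes "countable Q"
  shows "AE \<omega> in M. \<forall>u\<in>Q.
      (\<forall>f F. (\<forall>z. isCont f z) \<longrightarrow> (\<forall>z. \<bar>f z\<bar> \<le> F) \<longrightarrow>
        (\<lambda>n. (\<Sum>t=1..n. f (\<epsilon> t \<omega> + X t \<omega> \<bullet> u)) / real n) \<longlonglongrightarrow>
          (\<integral>z. f (sqrt (\<sigma>\<^sub>0\<^sup>2 + regressor_cov u 0) * z) \<partial>std_normal_distribution)) \<and>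
      (\<lambda>n. (\<Sum>t=1..n. (\<epsilon> t \<omega> + X t \<omega> \<bullet> u)\<^sup>2) / real n) \<longlonglongrightarrow> \<sigma>\<^sub>0\<^sup>2 + regressor_cov u 0"
proof (intro AE_ball_countable[THEN iffD2] ballI assms)
  fix u
  obtain C \<delta> where "decorrelating_pairs M (\<lambda>t \<omega>. \<epsilon> t \<omega> + X t \<omega> \<bullet> u) (\<sigma>\<^sub>0\<^sup>2 + regressor_cov u 0) C \<delta>"
    by (rule residual_decorrelates)
  then interpret u: decorrelating_pairs M "\<lambda>t \<omega>. \<epsilon> t \<omega> + X t \<omega> \<bullet> u" "\<sigma>\<^sub>0\<^sup>2 + regressor_cov u 0" C \<delta> .
  show "AE \<omega> in M. (\<forall>f F. (\<forall>z. isCont f z) \<longrightarrow> (\<forall>z. \<bar>f z\<bar> \<le> F) \<longrightarrow>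
        (\<lambda>n. (\<Sum>t=1..n. f (\<epsilon> t \<omega> + X t \<omega> \<bullet> u)) / real n) \<longlonglongrightarrow>
          (\<integral>z. f (sqrt (\<sigma>\<^sub>0\<^sup>2 + regressor_cov u 0) * z) \<partial>std_normal_distribution)) \<and>
      (\<lambda>n. (\<Sum>t=1..n. (\<epsilon> t \<omega> + X t \<omega> \<bullet> u)\<^sup>2) / real n) \<longlonglongrightarrow> \<sigma>\<^sub>0\<^sup>2 + regressor_cov u 0"
    using u.empirical_average u.square_average by eventually_elim (rule conjI)
qed

theorem corollary3p1:
  fixes M :: "'w measure"
    and X :: "nat \<Rightarrow> 'w \<Rightarrow> real ^ 'd"
    and \<epsilon> :: "nat \<Rightarrow> 'w \<Rightarrow> real"
    and Y :: "nat \<Rightarrow> 'w \<Rightarrow> nat \<Rightarrow> real"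
    and \<Upsilon> :: "(real ^ 'd) set"
    and \<beta>1\<^sub>0 \<beta>2\<^sub>0 :: "real ^ 'd"
    and \<pi>\<^sub>0 \<sigma>\<^sub>0 \<alpha> c c' K :: real
    and \<theta> :: "'d \<Rightarrow> real"
    and Lm :: "real \<Rightarrow> real ^ 'd ^ 'd"
    and L \<rho> \<psi> :: "real \<Rightarrow> real"
    and \<beta>1t \<beta>2t :: "nat \<Rightarrow> 'w \<Rightarrow> real \<Rightarrow> real ^ 'd"
    and \<pi>h :: "nat \<Rightarrow> 'w \<Rightarrow> real"
  assumes prob: "prob_space M"
    and compact: "compact \<Upsilon>"
    \<comment> \<open>the true parameter is admissible; this contains (vii)\<close>
    and true_param: "(\<beta>1\<^sub>0, \<beta>2\<^sub>0, \<pi>\<^sub>0) \<in> admissible \<Upsilon>"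
    and sigma_pos: "\<sigma>\<^sub>0 > 0"
    and model: "\<And>n \<omega> t. Y n \<omega> t = response (\<lambda>t. X t \<omega>) (\<lambda>t. \<epsilon> t \<omega>) \<beta>1\<^sub>0 \<beta>2\<^sub>0 \<pi>\<^sub>0 n t"
    \<comment> \<open>(i)\<close>
    and X_gauss: "gaussian_sequence M X" and X_stat: "stationary M X"
    and X_mean: "\<And>t. t \<ge> 1 \<Longrightarrow> (\<integral>\<omega>. X t \<omega> \<partial>M) = 0"
    and \<theta>: "\<And>i. 0 < \<theta> i \<and> \<theta> i < 1"
    and Lm: "slowly_varying_orthogonal Lm"
    and X_cov: "\<And>t. t \<ge> 1 \<Longrightarrow>
       autocov M X t = transpose (Lm (real t)) ** power_diag \<theta> t ** Lm (real t)"
    \<comment> \<open>(ii)\<close>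
    and eps_gauss: "gaussian_sequence M \<epsilon>" and eps_stat: "stationary M \<epsilon>"
    and eps_mean: "\<And>t. t \<ge> 1 \<Longrightarrow> (\<integral>\<omega>. \<epsilon> t \<omega> \<partial>M) = 0"
    and eps_var: "\<And>t. t \<ge> 1 \<Longrightarrow> (\<integral>\<omega>. (\<epsilon> t \<omega>)\<^sup>2 \<partial>M) = \<sigma>\<^sub>0\<^sup>2"
    and \<alpha>: "0 < \<alpha>" "\<alpha> < 1"
    and L: "slowly_varying L"
    and eps_cov: "\<And>t. t \<ge> 1 \<Longrightarrow>
       (\<integral>\<omega>. \<epsilon> 1 \<omega> * \<epsilon> (t + 1) \<omega> \<partial>M) = real t powr (- \<alpha>) * L (real t)"
    \<comment> \<open>(iii)\<close>
    and indep: "independent_sequences M \<epsilon> X"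
    and rho: "rho_function \<rho> c"
    and psi: "\<psi> = deriv \<rho>"
    and K: "K = (\<integral>\<omega>. \<rho> (\<epsilon> 1 \<omega> / \<sigma>\<^sub>0) \<partial>M)"
    \<comment> \<open>(iv); the printed condition is the case c' = c\<close>
    and psi_diff: "\<And>u. \<psi> differentiable (at u)"
    and c': "0 < c'" "c' \<le> c"
    and psi_deriv_pos: "\<And>u. 0 < u \<Longrightarrow> u < c' \<Longrightarrow> deriv \<psi> u > 0"
    \<comment> \<open>(v)\<close>
    and psi_diff2: "\<And>u. deriv \<psi> differentiable (at u)"
    and psi_deriv2_bdd: "bounded (range (deriv (deriv \<psi>)))"
    \<comment> \<open>(vi)\<close>
    and psi_over_id: "antimono_on {0<..} (\<lambda>u. \<psi> u / u)"
    \<comment> \<open>existence of the scale and definition of the S-estimators\<close>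
    and solvable: "AE \<omega> in M. \<forall>\<^sub>F n in sequentially. scale_solvable \<rho> K (Y n \<omega>) (\<lambda>t. X t \<omega>) n \<Upsilon>"
    and estimator: "\<And>n \<omega>. \<omega> \<in> space M \<Longrightarrow> scale_solvable \<rho> K (Y n \<omega>) (\<lambda>t. X t \<omega>) n \<Upsilon> \<Longrightarrow>
       is_S_estimator \<rho> K (Y n \<omega>) (\<lambda>t. X t \<omega>) n \<Upsilon> (\<beta>1t n \<omega>) (\<beta>2t n \<omega>) (\<pi>h n \<omega>)"
  shows "AE \<omega> in M.
    (\<lambda>n. s_scale \<rho> K (Y n \<omega>) (\<lambda>t. X t \<omega>) n
           (\<beta>1t n \<omega> (\<pi>h n \<omega>)) (\<beta>2t n \<omega> (\<pi>h n \<omega>)) (\<pi>h n \<omega>)) \<longlonglongrightarrow> \<sigma>\<^sub>0"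
proof -
  interpret gaussian_regression M X \<epsilon> \<sigma>\<^sub>0 \<alpha> \<theta> Lm L
    using prob X_gauss X_stat X_mean \<theta> Lm X_cov eps_gauss eps_stat eps_mean eps_var \<alpha>(1) L eps_cov indep
    by (intro gaussian_regression.intro gaussian_regression_axioms.intro) auto
  interpret bounded_loss \<rho> c by unfold_locales (rule rho)
  have params: "\<beta>1\<^sub>0 \<in> \<Upsilon>" "\<beta>2\<^sub>0 \<in> \<Upsilon>" "0 \<le> \<pi>\<^sub>0" "\<pi>\<^sub>0 \<le> 1"
    using true_param by (auto simp: admissible_def)
  have Y: "Y n \<omega> = response (\<lambda>t. X t \<omega>) (\<lambda>t. \<epsilon> t \<omega>) \<beta>1\<^sub>0 \<beta>2\<^sub>0 \<pi>\<^sub>0 n" for n \<omega>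
    by (rule ext) (rule model)
  have K1: "K = normal_mean 1"
  proof -
    have "K = (\<integral>z. \<rho> (sqrt (\<sigma>\<^sub>0\<^sup>2) * z / \<sigma>\<^sub>0) \<partial>std_normal_distribution)"
      unfolding K by (rule centred_gaussian_integral(2)[OF eps_centred, of 1 "\<lambda>z. \<rho> (z / \<sigma>\<^sub>0)"]) auto
    then show ?thesis using sigma_pos by (simp add: normal_mean_def)
  qed
  obtain D :: "(real ^ 'd) set" where D: "countable D"
    "\<And>V. open V \<Longrightarrow> V \<noteq> {} \<Longrightarrow> \<exists>d\<in>D. d \<in> V"
    using countable_dense_setE by blast
  define Q where "Q = D \<union> insert 0 (range (\<lambda>i. axis i 1))"
  have "countable Q" using D(1) by (simp add: Q_def countable_finite)
  from residual_averages[OF this] solvable AE_space show ?thesis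
  proof eventually_elim
    case (elim \<omega>)
    have squares: "(\<lambda>n. (\<Sum>t=1..n. (\<epsilon> t \<omega> + X t \<omega> \<bullet> u)\<^sup>2) / real n) \<longlonglongrightarrow> \<sigma>\<^sub>0\<^sup>2 + regressor_cov u 0"
      if "u \<in> insert 0 (range (\<lambda>i. axis i 1))" for u
      using elim(1) that unfolding Q_def by blast
    obtain A where A: "A > 0" "\<And>n. (\<Sum>t=1..n. norm (X t \<omega>)) \<le> A * real n"
      using norm_average_bound[OF squares] by blast
    show ?case unfolding Y
    proof (rule consistency_on_path[where Q=Q and v="\<lambda>u. regressor_cov u 0" and A=A,
          OF compact params sigma_pos _ _ regressor_var_nonneg _ _ A K1])
      show "\<exists>q\<in>Q. q \<in> V" if "open V" "V \<noteq> {}" for V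
        using D(2)[OF that] by (auto simp: Q_def)
      show "0 \<in> Q" by (simp add: Q_def)
      show "regressor_cov 0 0 = 0" by (simp add: regressor_cov_def)
      show "(\<lambda>n. (\<Sum>t=1..n. f (\<epsilon> t \<omega> + X t \<omega> \<bullet> u)) / real n) \<longlonglongrightarrow>
          (\<integral>z. f (sqrt (\<sigma>\<^sub>0\<^sup>2 + regressor_cov u 0) * z) \<partial>std_normal_distribution)"
        if "u \<in> Q" "\<And>z. isCont f z" "\<And>z. \<bar>f z\<bar> \<le> F" for u f F
        using elim(1) that by blast
    qed (use elim(2) estimator[OF elim(3)] in \<open>simp_all only: Y\<close>)
  qed
qed

end
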